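(* Let $n\ge1$, let $u,a,b,c,q$ be indeterminates, and let $U=\{u,uq,\ldots,uq^{n-1}\}$. For $1\le k\le n+1$ and $1\le j\le n$ define the $2n$-element multiset $$Y_{j,k}=\begin{cases}\{aq^{-m},\,cq^{m}/a:\ 0\le m\le n-j\}\cup\{bq^{m-n},\,cq^{n-m}/b:\ 1\le m\le j-1\},& 1\le j<k,\\[2pt] \{aq^{-m},\,cq^{m}/a:\ 0\le m\le n-j-1\}\cup\{bq^{m-n},\,cq^{n-m}/b:\ 1\le m\le j\},& k\le j\le n,\end{cases}$$ and let $F_{n,k}(U,A,B)=\det\bigl(h_{2n-i+1}(U-Y_{j,k})\bigr)_{i,j=1}^n$. Then for $1\le k\le n+1$, \begin{align*} F_{n,k}(U,A,B)&={n\brack k-1}q^{-\frac{n(n-1)(2n-1)}{6}}\,b^{\binom n2}\prod_{1\le i<j\le n}(c-u^2q^{i+j-2})\\ &\quad\times P_{n-k+1}(b,uq^{n-1})\,P_{k-1}(a,uq^{n-k+1})\,P_{n-k+1}(u,c/b)\,P_{k-1}(c/a,u)\\ &\quad\times\prod_{i=1}^{n-1}(1-aq^{i-1}/b)^{n-i}\prod_{\substack{j=0\\ j\ne n-k+1}}^{n-1}\ \prod_{\substack{i=j+1\\ i\ne n-k+1}}^{n}(1-cq^{i+j-1}/ab). \end{align*}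
   Context: For finite multisets of variables $X$ and $Y$, the supersymmetric complete function $h_m(X-Y)$ is the coefficient of $t^m$ in $\prod_{y\in Y}(1-yt)/\prod_{x\in X}(1-xt)$. $(x;q)_0=1$, $(x;q)_m=(1-x)(1-xq)\cdots(1-xq^{m-1})$; the Cauchy polynomial is $P_m(x,z)=x^m(z/x;q)_m$; ${n\brack k}=\frac{(q;q)_n}{(q;q)_k(q;q)_{n-k}}$.
   Formalization: The printed formula is off by a sign (for n=k=1, F=(u-b)(u-c/b) but the right-hand side is (b-u)(u-c/b)); the formal theorem multiplies the right-hand side by (-1)^{binom(n,2)+n-k+1}. *)

theory Defs
  imports
    "HOL-Library.Multiset"
    "HOL-Computational_Algebra.Formal_Power_Series"
    "Jordan_Normal_Form.Determinant"
begin

definition hsuper :: "nat \<Rightarrow> 'a::field multiset \<Rightarrow> 'a multiset \<Rightarrow> 'a" where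
  "hsuper m X Y =
     fps_nth ((\<Prod>y\<in>#Y. 1 - fps_const y * fps_X) / (\<Prod>x\<in>#X. 1 - fps_const x * fps_X)) m"

definition qpoch :: "'a::field \<Rightarrow> 'a \<Rightarrow> nat \<Rightarrow> 'a" where
  "qpoch x q m = (\<Prod>i<m. 1 - x * q ^ i)"

definition cauchyP :: "'a::field \<Rightarrow> nat \<Rightarrow> 'a \<Rightarrow> 'a \<Rightarrow> 'a" where
  "cauchyP q m x z = x ^ m * qpoch (z / x) q m"

definition qbinom :: "'a::field \<Rightarrow> nat \<Rightarrow> nat \<Rightarrow> 'a" where
  "qbinom q n k = qpoch q q n / (qpoch q q k * qpoch q q (n - k))"

definition Uset :: "nat \<Rightarrow> 'a::field \<Rightarrow> 'a \<Rightarrow> 'a multiset" where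
  "Uset n u q = {# u * q ^ i. i \<in># mset_set {0..<n} #}"

definition Apart :: "'a::field \<Rightarrow> 'a \<Rightarrow> 'a \<Rightarrow> nat set \<Rightarrow> 'a multiset" where
  "Apart a c q M =
     {# a * q powi (- int m). m \<in># mset_set M #} + {# c * q ^ m / a. m \<in># mset_set M #}"

definition Bpart :: "nat \<Rightarrow> 'a::field \<Rightarrow> 'a \<Rightarrow> 'a \<Rightarrow> nat set \<Rightarrow> 'a multiset" where
  "Bpart n b c q M =
     {# b * q powi (int m - int n). m \<in># mset_set M #} +
     {# c * q powi (int n - int m) / b. m \<in># mset_set M #}"

text \<open>Half-open ranges: \<open>{0..<n - j}\<close> is \<open>0 \<le> m \<le> n - j - 1\<close>, which is empty for \<open>j = n\<close>.\<close>

definition Yset :: "nat \<Rightarrow> 'a::field \<Rightarrow> 'a \<Rightarrow> 'a \<Rightarrow> 'a \<Rightarrow> nat \<Rightarrow> nat \<Rightarrow> 'a multiset" where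
  "Yset n a b c q j k =
     (if j < k then Apart a c q {0..n - j} + Bpart n b c q {1..<j}
      else Apart a c q {0..<n - j} + Bpart n b c q {1..j})"

text \<open>Matrix indices start at 0, so the entry at \<open>(i, j)\<close> is the one the formula
  \<open>h\<close> with index \<open>2 n - i + 1\<close> assigns to row \<open>i + 1\<close> and column \<open>j + 1\<close>.\<close>

definition Fdet :: "nat \<Rightarrow> nat \<Rightarrow> 'a::field \<Rightarrow> 'a \<Rightarrow> 'a \<Rightarrow> 'a \<Rightarrow> 'a \<Rightarrow> 'a" where
  "Fdet n k u a b c q =
     det (mat n n (\<lambda>(i, j).
       hsuper (2 * n - (i + 1) + 1) (Uset n u q) (Yset n a b c q (j + 1) k)))"

end

theory Submission
  imports Defs
    "HOL-Computational_Algebra.Polynomial_FPS"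
    "HOL-Computational_Algebra.Polynomial_Factorial"
begin

text \<open>
  Put \<open>u\<^sub>l = u q\<^sup>l\<close> and \<open>z\<^sub>l = u\<^sub>l + c / u\<^sub>l\<close>. In the range of indices that occurs,
  \<open>h\<^sub>m(U - Y)\<close> is the sum over \<open>l\<close> of residues \<open>u\<^sub>l\<^sup>m \<Prod>\<^sub>y (1 - y / u\<^sub>l) / \<Prod>\<^sub>i (1 - u\<^sub>i / u\<^sub>l)\<close>,
  and since the elements of \<open>Y\<close> come in pairs with product \<open>c\<close>, the product over \<open>Y\<close> is, up to a
  power of \<open>u\<^sub>l\<close>, the value at \<open>z\<^sub>l\<close> of a polynomial
  \<open>p\<^sub>r = \<Prod>\<^sub>i (z - \<alpha>\<^sub>i) \<Prod>\<^sub>i (z - \<beta>\<^sub>i)\<close> with \<open>n - r\<close> factors of the first kind and \<open>r\<close> of the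
  second, where \<open>\<alpha>\<^sub>i = a / q\<^sup>i + c q\<^sup>i / a\<close> and \<open>\<beta>\<^sub>i\<close> is the same with \<open>b q\<^bsup>i+1-n\<^esup>\<close> for \<open>a / q\<^sup>i\<close>.
  So the determinant is that of a Vandermonde-like matrix times the determinant of the values
  \<open>p\<^sub>r(z\<^sub>l)\<close> with \<open>r \<noteq> k - 1\<close>. By Cramer's rule the latter is, up to sign, the Vandermonde
  determinant of the \<open>z\<^sub>l\<close> times \<open>\<Prod>(\<beta>\<^sub>r - \<alpha>\<^sub>i)\<close> times the coefficient of \<open>p\<^bsub>k-1\<^esub>\<close> in the
  expansion of \<open>\<Prod>\<^sub>l (z - z\<^sub>l)\<close>. These coefficients satisfy a Pascal-type recursion, solved by an
  explicit product.
\<close>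

section \<open>Determinants of polynomial values\<close>

text \<open>Evaluation at \<open>x l\<close> is linear in the coefficients, so the matrix of values
  factors into powers of the nodes times coefficients.\<close>

lemma det_poly_eval:
  fixes P :: "nat \<Rightarrow> 'a::comm_ring_1 poly"
  assumes deg: "\<And>r. r < n \<Longrightarrow> degree (P r) < n"
  shows "det (mat n n (\<lambda>(l, r). poly (P r) (x l))) =
    det (mat n n (\<lambda>(l, k). x l ^ k)) * det (mat n n (\<lambda>(k, r). coeff (P r) k))"
proof -
  have eval: "poly (P r) y = (\<Sum>k<n. y ^ k * coeff (P r) k)" if "r < n" for r y
  proof -
    have "poly (P r) y = (\<Sum>k\<le>degree (P r). coeff (P r) k * y ^ k)"
      by (rule poly_altdef)
    also have "\<dots> = (\<Sum>k<n. coeff (P r) k * y ^ k)"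
      by (rule sum.mono_neutral_left) (use deg[OF that] in \<open>auto simp: coeff_eq_0\<close>)
    finally show ?thesis by (simp add: mult.commute)
  qed
  have "mat n n (\<lambda>(l, r). poly (P r) (x l)) =
      mat n n (\<lambda>(l, k). x l ^ k) * mat n n (\<lambda>(k, r). coeff (P r) k)"
    by (rule eq_matI) (auto simp: scalar_prod_def eval atLeast0LessThan)
  then show ?thesis by (simp add: det_mult[of _ n])
qed

lemma degree_prod_linear: "degree (\<Prod>i\<in>A. [:- x i, 1:] :: 'a::idom poly) = card A"
  by (subst degree_prod_sum_eq) auto

lemma monic_prod_linear: "coeff (\<Prod>i\<in>A. [:- x i, 1:] :: 'a::idom poly) (card A) = 1"
  using lead_coeff_prod[of "\<lambda>i. [:- x i, 1:]" A] by (simp add: degree_prod_linear)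

text \<open>Newton polynomials replace the monomials: their coefficient matrix is unitriangular, and
  their value matrix is triangular because \<open>P r\<close> vanishes at the first \<open>r\<close>
  nodes.\<close>

lemma det_vandermonde:
  fixes x :: "nat \<Rightarrow> 'a::idom"
  shows "det (mat n n (\<lambda>(l, k). x l ^ k)) = (\<Prod>j<n. \<Prod>i<j. x j - x i)"
proof -
  define P where "P r = (\<Prod>i<r. [:- x i, 1:])" for r
  have deg: "degree (P r) = r" for r
    by (simp add: P_def degree_prod_linear)
  have lead: "coeff (P r) r = 1" for r
    using monic_prod_linear[of x "{..<r}"] by (simp add: P_def)
  have ev: "poly (P r) y = (\<Prod>i<r. y - x i)" for r y
    by (simp add: P_def poly_prod)
  have "det (mat n n (\<lambda>(k, r). coeff (P r) k)) = 1"
    by (subst det_upper_triangular)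
      (auto simp: deg lead coeff_eq_0 prod_list_diag_prod)
  then have "det (mat n n (\<lambda>(l, k). x l ^ k)) = det (mat n n (\<lambda>(l, r). poly (P r) (x l)))"
    by (subst det_poly_eval) (auto simp: deg)
  also have "\<dots> = (\<Prod>j<n. \<Prod>i<j. x j - x i)"
    by (subst det_lower_triangular[of n])
      (auto simp: ev prod_list_diag_prod prod_zero_iff atLeast0LessThan)
  finally show ?thesis .
qed

section \<open>A basis mixing two node sequences, its coefficient determinant and Cramer's
  rule\<close>

text \<open>Along \<open>m + r = n\<close> these are \<open>n + 1\<close> monic polynomials of
  degree \<open>n\<close>, in which the nodes \<alpha> are traded for \<beta> one at a time. They
  are independent if no \<open>\<beta> r\<close> equals an \<open>\<alpha> i\<close> with
  \<open>r + i < n\<close>.\<close>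

definition mixed_basis :: "(nat \<Rightarrow> 'a::idom) \<Rightarrow> (nat \<Rightarrow> 'a) \<Rightarrow> nat \<Rightarrow> nat \<Rightarrow> 'a poly" where
  "mixed_basis \<alpha> \<beta> m r = (\<Prod>i<m. [:- \<alpha> i, 1:]) * (\<Prod>i<r. [:- \<beta> i, 1:])"

lemma degree_mixed_basis: "degree (mixed_basis \<alpha> \<beta> m r) = m + r"
  unfolding mixed_basis_def by (subst degree_mult_eq) (auto simp: degree_prod_linear)

lemma monic_mixed_basis: "coeff (mixed_basis \<alpha> \<beta> m r) (m + r) = 1"
  using coeff_mult_degree_sum[of "\<Prod>i<m. [:- \<alpha> i, 1:]" "\<Prod>i<r. [:- \<beta> i, 1:]"]
    monic_prod_linear[of \<alpha> "{..<m}"] monic_prod_linear[of \<beta> "{..<r}"]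
  by (simp add: mixed_basis_def degree_prod_linear)

text \<open>Neighbours share all but one linear factor, and the two differing factors have a
  constant difference.\<close>

lemma mixed_basis_diff:
  "mixed_basis \<alpha> \<beta> m (Suc r) - mixed_basis \<alpha> \<beta> (Suc m) r = smult (\<alpha> m - \<beta> r) (mixed_basis \<alpha> \<beta> m r)"
proof -
  have "mixed_basis \<alpha> \<beta> m (Suc r) - mixed_basis \<alpha> \<beta> (Suc m) r =
      mixed_basis \<alpha> \<beta> m r * ([:- \<beta> r, 1:] - [:- \<alpha> m, 1:])"
    unfolding mixed_basis_def prod.lessThan_Suc right_diff_distrib by (simp only: mult_ac)
  then show ?thesis by simp
qed

lemma det_border_unit_row:
  fixes A :: "'a::comm_ring_1 mat"
  assumes A: "A \<in> carrier_mat (Suc n) (Suc n)"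
    and row: "\<And>j. j < n \<Longrightarrow> A $$ (n, j) = 0" "A $$ (n, n) = 1"
  shows "det A = det (mat n n (\<lambda>(i, j). A $$ (i, j)))"
proof -
  have "det A = (\<Sum>j<Suc n. A $$ (n, j) * cofactor A n j)"
    by (rule laplace_expansion_row[OF A]) simp
  also have "\<dots> = cofactor A n n"
    using row by simp
  also have "\<dots> = det (mat_delete A n n)"
    by (simp add: cofactor_def flip: mult_2)
  also have "mat_delete A n n = mat n n (\<lambda>(i, j). A $$ (i, j))"
    using A by (intro eq_matI) (auto simp: mat_delete_def)
  finally show ?thesis .
qed

text \<open>Induction on the degree. Differences of neighbouring columns are multiples of the basis
  polynomials one degree lower, so after this column operation the last row is zero except for the
  leading \<open>1\<close> of the untouched last column.\<close>

lemma det_coeff_mixed_basis: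
  "det (mat (Suc n) (Suc n) (\<lambda>(k, r). coeff (mixed_basis \<alpha> \<beta> (n - r) r) k)) =
    (\<Prod>t<n. \<Prod>r\<le>t. \<beta> r - \<alpha> (t - r))"
proof (induction n)
  case 0
  show ?case by (simp add: det_single mixed_basis_def)
next
  case (Suc n)
  let ?N = "Suc (Suc n)"
  define M where "M = mat ?N ?N (\<lambda>(k, r). coeff (mixed_basis \<alpha> \<beta> (Suc n - r) r) k)"
  \<comment> \<open>Right multiplication by \<open>T\<close> replaces column \<open>j\<close> by
    column \<open>j + 1\<close> minus column \<open>j\<close> and keeps the last one.\<close>
  define T where "T = mat ?N ?N (\<lambda>(r, j). if r = j then if j = Suc n then 1 else - 1
     else if r = Suc j then 1 else (0 :: 'a))"
  define R where "R = mat (Suc n) (Suc n) (\<lambda>(k, r). coeff (mixed_basis \<alpha> \<beta> (n - r) r) k)"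
  define S where "S = mat (Suc n) (Suc n) (\<lambda>(k, r). if k = r then \<alpha> (n - r) - \<beta> r else 0)"
  have dims: "M \<in> carrier_mat ?N ?N" "T \<in> carrier_mat ?N ?N"
    "R \<in> carrier_mat (Suc n) (Suc n)" "S \<in> carrier_mat (Suc n) (Suc n)"
    by (auto simp: M_def T_def R_def S_def)
  have detT: "det T = (- 1) ^ Suc n"
    by (subst det_lower_triangular[of ?N]) (auto simp: T_def prod_list_diag_prod)
  have detS: "det S = (\<Prod>r\<le>n. \<alpha> (n - r) - \<beta> r)"
    by (subst det_lower_triangular[of "Suc n"])
      (auto simp: S_def prod_list_diag_prod atLeast0LessThan lessThan_Suc_atMost)
  have entry: "(M * T) $$ (k, j) = (if j = Suc n then coeff (mixed_basis \<alpha> \<beta> 0 (Suc n)) k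
      else (\<alpha> (n - j) - \<beta> j) * coeff (mixed_basis \<alpha> \<beta> (n - j) j) k)"
    if k: "k < ?N" and j: "j < ?N" for k j
  proof -
    have "(M * T) $$ (k, j) = (\<Sum>r\<in>{0..<?N}. coeff (mixed_basis \<alpha> \<beta> (Suc n - r) r) k * T $$ (r, j))"
      using k j by (simp add: M_def T_def scalar_prod_def)
    also have "\<dots> = (\<Sum>r\<in>{j, Suc j} \<inter> {0..<?N}. coeff (mixed_basis \<alpha> \<beta> (Suc n - r) r) k * T $$ (r, j))"
      using j by (intro sum.mono_neutral_right) (auto simp: T_def)
    also have "\<dots> = (if j = Suc n then coeff (mixed_basis \<alpha> \<beta> 0 (Suc n)) k
      else coeff (mixed_basis \<alpha> \<beta> (n - j) (Suc j) - mixed_basis \<alpha> \<beta> (Suc (n - j)) j) k)"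
    proof (cases "j = Suc n")
      case True
      then have "{j, Suc j} \<inter> {0..<?N} = {j}" by auto
      then show ?thesis using True by (simp add: T_def)
    next
      case False
      then have "{j, Suc j} \<inter> {0..<?N} = {j, Suc j}" "Suc n - j = Suc (n - j)" using j by auto
      then show ?thesis using False j by (simp add: T_def)
    qed
    also have "\<dots> = (if j = Suc n then coeff (mixed_basis \<alpha> \<beta> 0 (Suc n)) k
      else (\<alpha> (n - j) - \<beta> j) * coeff (mixed_basis \<alpha> \<beta> (n - j) j) k)"
      by (simp only: mixed_basis_diff coeff_smult)
    finally show ?thesis .
  qed
  have "det (M * T) = det (mat (Suc n) (Suc n) (\<lambda>(i, j). (M * T) $$ (i, j)))"
  proof (rule det_border_unit_row)
    show "M * T \<in> carrier_mat ?N ?N" using dims by simp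
    show "(M * T) $$ (Suc n, j) = 0" if "j < Suc n" for j
      using that by (simp add: entry coeff_eq_0 degree_mixed_basis)
    show "(M * T) $$ (Suc n, Suc n) = 1"
      using monic_mixed_basis[of \<alpha> \<beta> 0 "Suc n"] by (simp add: entry)
  qed
  also have "mat (Suc n) (Suc n) (\<lambda>(i, j). (M * T) $$ (i, j)) = R * S"
    by (rule eq_matI) (auto simp: entry R_def S_def scalar_prod_def if_distrib cong: if_cong)
  also have "det (R * S) = det R * det S"
    using dims by (simp add: det_mult[of _ "Suc n"])
  finally have "det M * (- 1) ^ Suc n = det R * (\<Prod>r\<le>n. \<alpha> (n - r) - \<beta> r)"
    using dims by (simp add: det_mult[of _ ?N] detT detS)
  \<comment> \<open>The diagonal of \<open>T\<close> contributes \<open>n + 1\<close> signs, exactly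
    enough to turn every difference around.\<close>
  also have "(\<Prod>r\<le>n. \<alpha> (n - r) - \<beta> r) = (\<Prod>r\<le>n. (- 1) * (\<beta> r - \<alpha> (n - r)))"
    by simp
  also have "\<dots> = (- 1) ^ Suc n * (\<Prod>r\<le>n. \<beta> r - \<alpha> (n - r))"
    by (subst prod.distrib) simp
  finally have "det M = det R * (\<Prod>r\<le>n. \<beta> r - \<alpha> (n - r))"
    by simp
  then show ?case
    using Suc.IH by (simp add: M_def R_def)
qed

text \<open>Border the values by a row of leading coefficients, all equal to \<open>1\<close>. The
  product of the factors \<open>[:- z l, 1:]\<close> vanishes at each \<open>z l\<close> and is
  monic, so its coefficient vector solves \<open>M c = e\<close> with \<open>e\<close> the last unit
  vector, and Cramer's rule expresses the minor without column \<open>s\<close> through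
  \<open>C s\<close>.\<close>

lemma det_mixed_basis_omit:
  fixes C :: "nat \<Rightarrow> 'a::idom"
  assumes C: "(\<Sum>r\<le>n. smult (C r) (mixed_basis \<alpha> \<beta> (n - r) r)) = (\<Prod>l<n. [:- z l, 1:])"
    and s: "s \<le> n"
  shows "det (mat n n (\<lambda>(l, j). poly (mixed_basis \<alpha> \<beta> (n - insert_index s j) (insert_index s j)) (z l))) =
    (- 1) ^ (n + s) * C s * (\<Prod>j<n. \<Prod>i<j. z j - z i) * (\<Prod>t<n. \<Prod>r\<le>t. \<beta> r - \<alpha> (t - r))"
proof -
  let ?N = "Suc n"
  define p where "p r = mixed_basis \<alpha> \<beta> (n - r) r" for r
  \<comment> \<open>The last row of \<open>W\<close> reads off the coefficient of degree
    \<open>n\<close>, in place of a value at a further node.\<close>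
  define W where "W = mat ?N ?N (\<lambda>(l, k). if l = n then of_bool (k = n) else z l ^ k)"
  define K where "K = mat ?N ?N (\<lambda>(k, r). coeff (p r) k)"
  define M where "M = mat ?N ?N (\<lambda>(l, r). if l = n then 1 else poly (p r) (z l))"
  define e where "e = vec ?N (\<lambda>l. of_bool (l = n) :: 'a)"
  define c where "c = vec ?N C"
  have deg: "degree (p r) = n" "coeff (p r) n = 1" if "r \<le> n" for r
    using that monic_mixed_basis[of \<alpha> \<beta> "n - r" r] by (auto simp: p_def degree_mixed_basis)
  have "det W = det (mat n n (\<lambda>(l, k). z l ^ k))"
    by (subst det_border_unit_row[of _ n])
      (auto simp: W_def intro!: arg_cong[where f = det] eq_matI)
  then have detW: "det W = (\<Prod>j<n. \<Prod>i<j. z j - z i)"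
    by (simp add: det_vandermonde)
  have detK: "det K = (\<Prod>t<n. \<Prod>r\<le>t. \<beta> r - \<alpha> (t - r))"
    by (simp add: K_def p_def det_coeff_mixed_basis)
  have MWK: "M = W * K"
  proof (rule eq_matI)
    fix l r assume "l < dim_row (W * K)" "r < dim_col (W * K)"
    then have lr: "l < ?N" "r < ?N" by (auto simp: W_def K_def)
    have "(W * K) $$ (l, r) = (\<Sum>k\<le>n. (if l = n then of_bool (k = n) else z l ^ k) * coeff (p r) k)"
      using lr by (simp add: W_def K_def scalar_prod_def atLeast0LessThan lessThan_Suc_atMost)
    also have "\<dots> = (if l = n then 1 else poly (p r) (z l))"
    proof (cases "l = n")
      case True
      have "(\<Sum>k\<le>n. of_bool (k = n) * coeff (p r) k) = (\<Sum>k\<in>{n}. coeff (p r) k)"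
        by (rule sum.mono_neutral_cong_right) auto
      then show ?thesis using True lr deg(2)[of r] by simp
    next
      case False
      then show ?thesis using lr deg(1)[of r] by (simp add: poly_altdef mult.commute)
    qed
    finally show "M $$ (l, r) = (W * K) $$ (l, r)" using lr by (simp add: M_def)
  qed (auto simp: M_def W_def K_def)
  have dims: "M \<in> carrier_mat ?N ?N" "W \<in> carrier_mat ?N ?N" "K \<in> carrier_mat ?N ?N"
    by (auto simp: M_def W_def K_def)
  have Mc: "M *\<^sub>v c = e"
  proof (rule eq_vecI)
    fix l assume "l < dim_vec e"
    then have l: "l < ?N" by (simp add: e_def)
    have "(M *\<^sub>v c) $ l = (\<Sum>r\<le>n. (if l = n then 1 else poly (p r) (z l)) * C r)"
      using l by (simp add: M_def c_def scalar_prod_def atLeast0LessThan lessThan_Suc_atMost)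
    also have "\<dots> = of_bool (l = n)"
    proof (cases "l = n")
      case True
      have "(\<Sum>r\<le>n. C r) = coeff (\<Sum>r\<le>n. smult (C r) (p r)) n"
        by (simp add: coeff_sum deg)
      also have "\<dots> = 1"
        using C monic_prod_linear[of z "{..<n}"] by (simp add: p_def)
      finally show ?thesis using True by simp
    next
      case False
      have "(\<Sum>r\<le>n. poly (p r) (z l) * C r) = poly (\<Sum>r\<le>n. smult (C r) (p r)) (z l)"
        by (simp add: poly_sum mult.commute)
      also have "\<dots> = 0"
        using C False l by (auto simp: p_def poly_prod)
      finally show ?thesis using False by simp
    qed
    finally show "(M *\<^sub>v c) $ l = e $ l" using l by (simp add: e_def)
  qed (auto simp: M_def e_def)
  have "det (replace_col M e s) = C s * det M"
    using cramer_lemma_mat[of M ?N c s, unfolded Mc] dims s by (simp add: c_def)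
  also have "det M = det W * det K"
    unfolding MWK using dims by (simp add: det_mult[of _ ?N])
  finally have 1: "det (replace_col M e s) = C s * (det W * det K)" .
  \<comment> \<open>Column \<open>s\<close> is now \<open>e\<close>, so the expansion along it keeps
    only the minor without the bordering row.\<close>
  have "det (replace_col M e s) = (\<Sum>i<?N. replace_col M e s $$ (i, s) * cofactor (replace_col M e s) i s)"
    by (rule laplace_expansion_column) (use dims s in \<open>auto simp: replace_col_def\<close>)
  also have "\<dots> = cofactor (replace_col M e s) n s"
    using s by (simp add: replace_col_def M_def e_def)
  also have "\<dots> = (- 1) ^ (n + s) * det (mat_delete (replace_col M e s) n s)"
    by (simp add: cofactor_def)
  also have "mat_delete (replace_col M e s) n s = mat n n (\<lambda>(l, j). poly (p (insert_index s j)) (z l))"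
    by (intro eq_matI) (auto simp: mat_delete_def replace_col_def M_def insert_index_def)
  finally have 2: "det (mat n n (\<lambda>(l, j). poly (p (insert_index s j)) (z l)))
      = (- 1) ^ (n + s) * det (replace_col M e s)"
    by simp
  show ?thesis using 1 2 by (simp add: p_def detW detK)
qed

section \<open>Expansion of a product of linear factors in the mixed basis\<close>

text \<open>As \<open>\<alpha> m\<close> and \<open>\<beta> r\<close> differ, \<open>z\<close> is an
  affine combination of them, and \<open>[:- z, 1:]\<close> is the same combination of the two
  linear factors that lead to the next basis polynomials.\<close>

lemma mixed_basis_mult_linear:
  fixes \<alpha> \<beta> :: "nat \<Rightarrow> 'a::field"
  assumes "\<beta> r \<noteq> \<alpha> m"
  shows "mixed_basis \<alpha> \<beta> m r * [:- z, 1:] =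
    smult ((\<beta> r - z) / (\<beta> r - \<alpha> m)) (mixed_basis \<alpha> \<beta> (Suc m) r) +
    smult ((z - \<alpha> m) / (\<beta> r - \<alpha> m)) (mixed_basis \<alpha> \<beta> m (Suc r))"
proof -
  define x y where "x = (\<beta> r - z) / (\<beta> r - \<alpha> m)" and "y = (z - \<alpha> m) / (\<beta> r - \<alpha> m)"
  have "x + y = 1" "x * \<alpha> m + y * \<beta> r = z"
    using assms by (simp_all add: x_def y_def divide_simps) (simp_all add: algebra_simps)
  then have lin: "[:- z, 1:] = smult x [:- \<alpha> m, 1:] + smult y [:- \<beta> r, 1:]"
    by (simp add: algebra_simps)
  have "mixed_basis \<alpha> \<beta> (Suc m) r = mixed_basis \<alpha> \<beta> m r * [:- \<alpha> m, 1:]"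
    "mixed_basis \<alpha> \<beta> m (Suc r) = mixed_basis \<alpha> \<beta> m r * [:- \<beta> r, 1:]"
    unfolding mixed_basis_def prod.lessThan_Suc by (simp_all only: mult_ac)
  then show ?thesis
    unfolding lin x_def[symmetric] y_def[symmetric]
    by (simp only: mult_smult_right distrib_left)
qed

text \<open>Multiplication by the next factor sends each basis polynomial to its two successors, so
  a coefficient collects one contribution from each of its two predecessors; on the edges
  \<open>r = 0\<close> and \<open>m = 0\<close> there is only one predecessor.\<close>

lemma mixed_basis_expansion:
  fixes \<alpha> \<beta> z :: "nat \<Rightarrow> 'a::field"
  assumes ne: "\<And>m r. m + r < N \<Longrightarrow> \<beta> r \<noteq> \<alpha> m"
    and C00: "C 0 0 = 1"
    and C0: "\<And>m. m < N \<Longrightarrow> C (Suc m) 0 = (\<beta> 0 - z m) / (\<beta> 0 - \<alpha> m) * C m 0"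
    and C1: "\<And>r. r < N \<Longrightarrow> C 0 (Suc r) = (z r - \<alpha> 0) / (\<beta> r - \<alpha> 0) * C 0 r"
    and C2: "\<And>m r. Suc (m + r) < N \<Longrightarrow> C (Suc m) (Suc r) =
      (\<beta> (Suc r) - z (Suc (m + r))) / (\<beta> (Suc r) - \<alpha> m) * C m (Suc r) +
      (z (Suc (m + r)) - \<alpha> (Suc m)) / (\<beta> r - \<alpha> (Suc m)) * C (Suc m) r"
    and "n \<le> N"
  shows "(\<Sum>r\<le>n. smult (C (n - r) r) (mixed_basis \<alpha> \<beta> (n - r) r)) = (\<Prod>l<n. [:- z l, 1:])"
  using \<open>n \<le> N\<close>
proof (induction n)
  case 0
  then show ?case by (simp add: C00 mixed_basis_def)
next
  case (Suc n)
  define x where "x m r = (\<beta> r - z n) / (\<beta> r - \<alpha> m)" for m r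
  define y where "y m r = (z n - \<alpha> m) / (\<beta> r - \<alpha> m)" for m r
  let ?p = "mixed_basis \<alpha> \<beta>"
  have step: "C (n - r) (Suc r) = x (n - Suc r) (Suc r) * C (n - Suc r) (Suc r) + y (n - r) r * C (n - r) r"
    if "r < n" for r
  proof -
    define m where "m = n - Suc r"
    have "n = Suc (m + r)" using that by (simp add: m_def)
    then show ?thesis using C2[of m r] Suc.prems by (simp add: x_def y_def)
  qed
  have "(\<Prod>l<Suc n. [:- z l, 1:]) = (\<Sum>r\<le>n. smult (C (n - r) r) (?p (n - r) r * [:- z n, 1:]))"
    using Suc by (simp only: prod.lessThan_Suc Suc_leD flip: Suc.IH) (simp only: sum_distrib_right mult_smult_left)
  also have "\<dots> = (\<Sum>r\<le>n. smult (x (n - r) r * C (n - r) r) (?p (Suc (n - r)) r) +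
      smult (y (n - r) r * C (n - r) r) (?p (n - r) (Suc r)))"
    using Suc.prems by (intro sum.cong refl, subst mixed_basis_mult_linear)
      (auto simp: ne x_def y_def smult_add_right mult.commute)
  also have "\<dots> = (\<Sum>r\<le>n. smult (x (n - r) r * C (n - r) r) (?p (Suc n - r) r)) +
      (\<Sum>r\<le>n. smult (y (n - r) r * C (n - r) r) (?p (n - r) (Suc r)))"
    by (simp add: sum.distrib Suc_diff_le)
  \<comment> \<open>Shifting the first sum by one in \<open>r\<close> makes both sums run over the
    same polynomials; its first term and the last term of the other sum are the edge
    coefficients.\<close>
  also have "(\<Sum>r\<le>n. smult (x (n - r) r * C (n - r) r) (?p (Suc n - r) r)) =
      smult (C (Suc n) 0) (?p (Suc n) 0) +
      (\<Sum>r<n. smult (x (n - Suc r) (Suc r) * C (n - Suc r) (Suc r)) (?p (n - r) (Suc r)))"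
    using C0[of n] Suc.prems by (simp add: sum.atMost_shift x_def)
  also have "(\<Sum>r\<le>n. smult (y (n - r) r * C (n - r) r) (?p (n - r) (Suc r))) =
      (\<Sum>r<n. smult (y (n - r) r * C (n - r) r) (?p (n - r) (Suc r))) +
      smult (C 0 (Suc n)) (?p 0 (Suc n))"
    using C1[of n] Suc.prems by (simp add: y_def flip: lessThan_Suc_atMost)
  also have "smult (C (Suc n) 0) (?p (Suc n) 0) +
      (\<Sum>r<n. smult (x (n - Suc r) (Suc r) * C (n - Suc r) (Suc r)) (?p (n - r) (Suc r))) +
      ((\<Sum>r<n. smult (y (n - r) r * C (n - r) r) (?p (n - r) (Suc r))) +
      smult (C 0 (Suc n)) (?p 0 (Suc n))) =
      smult (C (Suc n) 0) (?p (Suc n) 0) +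
      ((\<Sum>r<n. smult (C (n - r) (Suc r)) (?p (n - r) (Suc r))) +
      smult (C 0 (Suc n)) (?p 0 (Suc n)))"
    by (simp add: step smult_add_left sum.distrib)
  also have "\<dots> = (\<Sum>r\<le>Suc n. smult (C (Suc n - r) r) (?p (Suc n - r) r))"
    unfolding sum.atMost_Suc_shift by (simp flip: lessThan_Suc_atMost)
  finally show ?case by simp
qed

section \<open>Closed form of the expansion coefficients\<close>

text \<open>The recursion of \<open>mixed_basis_expansion\<close> for the coefficients \<open>mixed_coeff\<close> below,
  divided by the common factors, with \<open>A = q\<^sup>m\<close> and \<open>B = q\<^sup>r\<close>.\<close>

lemma coefficient_identity:
  fixes a d b u q A B :: "'a::comm_ring_1"
  shows "(1 - q * q * A * B) * (a - u * q * A * B) * (u * b * q * A * B - a * d) * (b * B - d * A) =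
    (a - u * A) * (u * b * q * q * A * B * B - a * d) * (1 - q * A) * B * (b - d * q * A) -
    A * (u * b * B - a * d) * (u * q * q * A * A * B - a) * (1 - q * B) * (b * q * B - d)"
  by (simp add: algebra_simps)

text \<open>Solution of the Pascal-type recursion for nodes in geometric progression. The
  denominator contains \<open>b - d * q ^ e\<close> for all exponents \<open>e\<close> from
  \<open>- r\<close> to \<open>m\<close>; the last numerator factor removes the exponent
  \<open>m - r\<close> from this range.\<close>

definition mixed_coeff :: "'a::field \<Rightarrow> 'a \<Rightarrow> 'a \<Rightarrow> 'a \<Rightarrow> 'a \<Rightarrow> nat \<Rightarrow> nat \<Rightarrow> 'a" where
  "mixed_coeff a d b u q m r =
     (- 1) ^ (m + r) * b ^ r * q ^ (m choose 2) * qbinom q (m + r) r *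
     (\<Prod>i<m. b - u * q ^ i) * (\<Prod>i<r. a - u * q ^ (m + i)) *
     (\<Prod>i<m. u * b - a * d / q ^ (r + i)) * (\<Prod>i<r. d - u * q ^ i) * (b - d * q ^ m / q ^ r) /
     (q ^ (r choose 2) * u ^ (m + r) * (\<Prod>t<m + r. a - b * q ^ t) *
      (\<Prod>e\<le>m. b - d * q ^ e) * (\<Prod>e<r. b - d / q ^ Suc e))"

lemma choose2_0: "0 choose 2 = 0"
  by (simp add: binomial_eq_0)

lemma choose2_Suc: "Suc m choose 2 = (m choose 2) + m"
  by (simp add: numeral_2_eq_2)

text \<open>Here \<open>d\<close> stands for \<open>c / a\<close>, and \<open>b\<close> for the
  theorem's \<open>b\<close> divided by \<open>q ^ (n - 1)\<close>. The bound \<open>N\<close> keeps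
  the q-factorials nonzero; the last three conditions keep every \<open>\<beta> r\<close> away from
  every \<open>\<alpha> i\<close>.\<close>

locale generic_parameters =
  fixes a d b u q :: "'a::field" and N :: nat
  assumes u0: "u \<noteq> 0" and b0: "b \<noteq> 0" and q0: "q \<noteq> 0"
    and q_neq: "\<And>i. i < N \<Longrightarrow> q ^ Suc i \<noteq> 1"
    and a_neq: "\<And>t. a \<noteq> b * q ^ t"
    and b_neq: "\<And>e. b \<noteq> d * q ^ e"
    and d_neq: "\<And>e. d \<noteq> b * q ^ e"
begin

definition \<alpha> where "\<alpha> i = a / q ^ i + d * q ^ i" for i :: nat
definition \<beta> where "\<beta> i = b * q ^ i + a * d / (b * q ^ i)" for i :: nat
definition z where "z l = u * q ^ l + a * d / (u * q ^ l)" for l :: nat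

text \<open>Each node is a sum of two numbers with product \<open>a * d\<close>. If
  \<open>x * x' = y * y'\<close>, then \<open>x + x' - (y + y') = (x - y) * (x - y') / x\<close>;
  the next two lemmas rest on the same factorization.\<close>

lemma beta_minus_alpha:
  "\<beta> r - \<alpha> i = (b * q ^ (r + i) - a) * (b * q ^ r - d * q ^ i) / (b * q ^ (r + i))"
  using q0 b0 by (simp add: \<alpha>_def \<beta>_def field_simps power_add)

lemma beta_minus_z:
  "\<beta> r - z l = (b * q ^ r - u * q ^ l) * (u * b * q ^ (r + l) - a * d) / (u * b * q ^ (r + l))"
  using q0 b0 u0 by (simp add: z_def \<beta>_def field_simps power_add)

lemma z_minus_alpha:
  "z l - \<alpha> i = (u * q ^ (l + i) - a) * (u * q ^ l - d * q ^ i) / (u * q ^ (l + i))"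
  using q0 u0 by (simp add: z_def \<alpha>_def field_simps power_add)

lemma diff_nonzero: "b * q ^ r - d * q ^ i \<noteq> 0"
proof (cases "r \<le> i")
  case True
  then have "b * q ^ r - d * q ^ i = q ^ r * (b - d * q ^ (i - r))"
    by (simp add: algebra_simps flip: power_add)
  then show ?thesis using b_neq q0 by simp
next
  case False
  then have "b * q ^ r - d * q ^ i = q ^ i * (b * q ^ (r - i) - d)"
    by (simp add: algebra_simps flip: power_add)
  then show ?thesis using d_neq[of "r - i"] q0 by auto
qed

lemma beta_neq_alpha: "\<beta> r \<noteq> \<alpha> i"
  using beta_minus_alpha[of r i] diff_nonzero[of r i] a_neq[of "r + i"] b0 q0 by auto

lemma qpoch_nonzero:
  assumes "l \<le> N"
  shows "qpoch q q l \<noteq> 0"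
  using q_neq assms by (auto simp: qpoch_def)

lemma mixed_coeff_Suc_0:
  assumes "m < N"
  shows "mixed_coeff a d b u q (Suc m) 0 =
    (\<beta> 0 - z m) / (\<beta> 0 - \<alpha> m) * mixed_coeff a d b u q m 0"
proof -
  define A where "A = q ^ m"
  \<comment> \<open>At \<open>r = 0\<close> the numerator factor \<open>b - d * q ^ m\<close>
    cancels the last factor of the denominator, so \<open>K\<close> runs over \<open>e < m\<close>
    only.\<close>
  define K where "K = (- 1) ^ m * q ^ (m choose 2) * (\<Prod>i<m. b - u * q ^ i) *
     (\<Prod>i<m. u * b - a * d / q ^ i) /
     (u ^ m * (\<Prod>t<m. a - b * q ^ t) * (\<Prod>e<m. b - d * q ^ e))"
  have nz: "A \<noteq> 0" "b - d * A \<noteq> 0" "a - b * A \<noteq> 0" "b * A - a \<noteq> 0" "b - d * (q * A) \<noteq> 0"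
    using b_neq[of m] b_neq[of "Suc m"] a_neq[of m] q0 by (auto simp: A_def)
  have qb: "qbinom q l 0 = 1" if "l \<le> N" for l
    using qpoch_nonzero[OF that] by (simp add: qbinom_def) (simp add: qpoch_def)
  have C0: "mixed_coeff a d b u q m 0 = K"
    using nz assms unfolding mixed_coeff_def K_def
    by (simp add: qb choose2_0 flip: A_def lessThan_Suc_atMost) (simp only: mult_ac)
  have C1: "mixed_coeff a d b u q (Suc m) 0 =
     - (K * (A * (b - u * A) * (u * b - a * d / A) / (u * (a - b * A) * (b - d * A))))"
    using nz assms unfolding mixed_coeff_def K_def
    by (simp add: qb choose2_0 choose2_Suc power_add flip: A_def lessThan_Suc_atMost) (simp only: mult_ac)
  show ?thesis
    unfolding beta_minus_alpha beta_minus_z C0 C1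
    using nz u0 b0 by (simp add: A_def[symmetric] divide_simps) (simp add: algebra_simps)
qed

lemma mixed_coeff_0_Suc:
  assumes "r < N"
  shows "mixed_coeff a d b u q 0 (Suc r) =
    (z r - \<alpha> 0) / (\<beta> r - \<alpha> 0) * mixed_coeff a d b u q 0 r"
proof -
  define B where "B = q ^ r"
  define K where "K = (- 1) ^ r * b ^ r * (\<Prod>i<r. a - u * q ^ i) * (\<Prod>i<r. d - u * q ^ i) /
     (q ^ (r choose 2) * u ^ r * (\<Prod>t<r. a - b * q ^ t) * (b - d) * (\<Prod>e<r. b - d / q ^ Suc e))"
  have nz: "B \<noteq> 0" "b - d \<noteq> 0" "a - b * B \<noteq> 0" "b * B - a \<noteq> 0" "b * B - d \<noteq> 0" "b * B * q - d \<noteq> 0"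
    using b_neq[of 0] a_neq[of r] q0 d_neq[of r] d_neq[of "Suc r"] by (auto simp: B_def mult_ac)
  have nz': "b - d / (q * B) \<noteq> 0"
    using nz q0 by (simp add: field_simps)
  have qb: "qbinom q l l = 1" if "l \<le> N" for l
    using qpoch_nonzero[OF that] by (simp add: qbinom_def) (simp add: qpoch_def)
  have C0: "mixed_coeff a d b u q 0 r = K * (b - d / B)"
    using assms unfolding mixed_coeff_def K_def by (simp add: qb choose2_0 flip: B_def)
  have C1: "mixed_coeff a d b u q 0 (Suc r) =
     - (K * (b * (a - u * B) * (d - u * B) / (B * u * (a - b * B))))"
    using nz nz' assms unfolding mixed_coeff_def K_def
    by (simp add: qb choose2_0 choose2_Suc power_add flip: B_def) (simp only: mult_ac)
  show ?thesis
    unfolding beta_minus_alpha z_minus_alpha C0 C1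
    using nz u0 b0 by (simp add: B_def[symmetric] divide_simps) (simp add: algebra_simps)
qed

lemma mixed_coeff_Suc_Suc:
  assumes "Suc (m + r) < N"
  shows "mixed_coeff a d b u q (Suc m) (Suc r) =
      (\<beta> (Suc r) - z (Suc (m + r))) / (\<beta> (Suc r) - \<alpha> m) * mixed_coeff a d b u q m (Suc r) +
      (z (Suc (m + r)) - \<alpha> (Suc m)) / (\<beta> r - \<alpha> (Suc m)) * mixed_coeff a d b u q (Suc m) r"
proof -
  define A where "A = q ^ m"
  define B where "B = q ^ r"
  have AB: "A \<noteq> 0" "B \<noteq> 0" using q0 by (auto simp: A_def B_def)
  have n1: "1 - q * A \<noteq> 0" "1 - q * B \<noteq> 0"
    using q_neq[of m] q_neq[of r] assms by (auto simp: A_def B_def)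
  have n2: "b * q * A * B - a \<noteq> 0"
    using a_neq[of "Suc (m + r)"] by (auto simp: A_def B_def power_add mult_ac)
  have n3: "b * q * B - d \<noteq> 0"
    using d_neq[of "Suc r"] by (auto simp: B_def mult_ac)
  have n4: "b - d * q * A \<noteq> 0"
    using b_neq[of "Suc m"] by (auto simp: A_def mult_ac)
  have n5: "b * q * B - d * A \<noteq> 0" "b * B - d * q * A \<noteq> 0"
    using diff_nonzero[of "Suc r" m] diff_nonzero[of r "Suc m"] by (auto simp: A_def B_def mult_ac)
  note nz = AB n1 n2 n3 n4 n5 u0 b0 q0
  \<comment> \<open>\<open>K\<close> collects what the three coefficients share; each is then
    \<open>K\<close> times a rational function of \<open>A\<close> and \<open>B\<close>.\<close>
  define K where "K = (- 1) ^ Suc (m + r) * b ^ r * q ^ (m choose 2) *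
      (qpoch q q (Suc (m + r)) / (qpoch q q m * qpoch q q r)) *
     (\<Prod>i<m. b - u * q ^ i) * (\<Prod>i<r. a - u * q ^ (Suc m + i)) *
     (\<Prod>i<m. u * b - a * d / q ^ (Suc r + i)) * (\<Prod>i<r. d - u * q ^ i) /
     (q ^ (r choose 2) * u ^ Suc (m + r) * (\<Prod>t<Suc (m + r). a - b * q ^ t) *
      (\<Prod>e\<le>m. b - d * q ^ e) * (\<Prod>e<r. b - d / q ^ Suc e))"
  \<comment> \<open>These two products start at an index that moves with \<open>m\<close> or
    \<open>r\<close>, so their first factor is peeled off; in \<open>split\<close> it is the last
    one.\<close>
  have shift:
    "(\<Prod>i<Suc r. a - u * q ^ (m + i)) = (a - u * A) * (\<Prod>i<r. a - u * q ^ (Suc m + i))"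
    "(\<Prod>i<Suc m. u * b - a * d / q ^ (r + i)) = (u * b - a * d / B) * (\<Prod>i<m. u * b - a * d / q ^ (Suc r + i))"
    unfolding A_def B_def by (simp_all add: prod.lessThan_Suc_shift del: prod.lessThan_Suc)
  have split: "(\<Prod>i<Suc m. b - u * q ^ i) = (\<Prod>i<m. b - u * q ^ i) * (b - u * A)"
    "(\<Prod>i<Suc r. a - u * q ^ (Suc m + i)) = (\<Prod>i<r. a - u * q ^ (Suc m + i)) * (a - u * q * A * B)"
    "(\<Prod>i<Suc m. u * b - a * d / q ^ (Suc r + i)) =
      (\<Prod>i<m. u * b - a * d / q ^ (Suc r + i)) * (u * b - a * d / (q * A * B))"
    "(\<Prod>i<Suc r. d - u * q ^ i) = (\<Prod>i<r. d - u * q ^ i) * (d - u * B)"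
    "(\<Prod>t<Suc (Suc (m + r)). a - b * q ^ t) = (\<Prod>t<Suc (m + r). a - b * q ^ t) * (a - b * q * A * B)"
    "(\<Prod>e\<le>Suc m. b - d * q ^ e) = (\<Prod>e\<le>m. b - d * q ^ e) * (b - d * q * A)"
    "(\<Prod>e<Suc r. b - d / q ^ Suc e) = (\<Prod>e<r. b - d / q ^ Suc e) * (b - d / (q * B))"
    "qpoch q q (Suc m) = qpoch q q m * (1 - q * A)"
    "qpoch q q (Suc r) = qpoch q q r * (1 - q * B)"
    "qpoch q q (Suc (Suc (m + r))) = qpoch q q (Suc (m + r)) * (1 - q * q * A * B)"
    "q ^ (Suc m choose 2) = q ^ (m choose 2) * A" "q ^ (Suc r choose 2) = q ^ (r choose 2) * B"
    unfolding A_def B_def qpoch_def choose2_Suc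
    by (simp_all add: power_add mult_ac)
  have pows: "q ^ Suc m = q * A" "q ^ Suc r = q * B" "q ^ m = A" "q ^ r = B"
    "d * (q * A) / (q * B) = d * A / B"
    using q0 by (simp_all add: A_def B_def)
  have ind: "m + Suc r = Suc (m + r)" "Suc m + r = Suc (m + r)" "Suc m + Suc r = Suc (Suc (m + r))"
    by auto
  have qbs: "qbinom q (Suc (m + r)) (Suc r) = qpoch q q (Suc (m + r)) / (qpoch q q m * qpoch q q r) / (1 - q * B)"
    "qbinom q (Suc (m + r)) r = qpoch q q (Suc (m + r)) / (qpoch q q m * qpoch q q r) / (1 - q * A)"
    "qbinom q (Suc (Suc (m + r))) (Suc r) = qpoch q q (Suc (m + r)) / (qpoch q q m * qpoch q q r) *
       ((1 - q * q * A * B) / ((1 - q * A) * (1 - q * B)))"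
    by (simp_all add: qbinom_def split(8,9,10) Suc_diff_le mult_ac)
  have C01: "mixed_coeff a d b u q m (Suc r) =
      K * (b * (a - u * A) * (d - u * B) * (b - d * A / (q * B)) / (B * (1 - q * B) * (b - d / (q * B))))"
    unfolding mixed_coeff_def K_def ind qbs shift split pows
    by (simp only: power_Suc times_divide_eq_left times_divide_eq_right divide_divide_eq_left
        divide_divide_eq_right mult_minus_left mult_minus_right minus_divide_left mult_1 mult_ac)
  have C10: "mixed_coeff a d b u q (Suc m) r =
      K * (A * (b - u * A) * (u * b - a * d / B) * (b - d * q * A / B) / ((1 - q * A) * (b - d * q * A)))"
    unfolding mixed_coeff_def K_def ind qbs shift split pows
    by (simp only: power_Suc times_divide_eq_left times_divide_eq_right divide_divide_eq_left
        divide_divide_eq_right mult_minus_left mult_minus_right minus_divide_left mult_1 mult_ac)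
  have C11: "mixed_coeff a d b u q (Suc m) (Suc r) =
      - (K * (b * A * (1 - q * q * A * B) * (b - u * A) * (a - u * q * A * B) * (u * b - a * d / (q * A * B)) *
         (d - u * B) * (b - d * A / B) /
       (B * u * (1 - q * A) * (1 - q * B) * (a - b * q * A * B) * (b - d / (q * B)) * (b - d * q * A))))"
    unfolding mixed_coeff_def K_def ind qbs shift split pows
    by (simp only: power_Suc times_divide_eq_left times_divide_eq_right divide_divide_eq_left
        divide_divide_eq_right mult_minus_left mult_minus_right minus_divide_left mult_1 mult_ac)
  \<comment> \<open>With the nonzero denominators as atoms, fractions can be cleared without
    multiplying these factors out.\<close>
  define D1 D2 D3 D4 D5 D6 D7 where "D1 = b * q * A * B - a" and "D2 = b * q * B - d * A"
    and "D3 = b * q * B - d" and "D4 = b - d * q * A" and "D5 = 1 - q * A" and "D6 = 1 - q * B"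
    and "D7 = b * B - d * q * A"
  note D = D1_def D2_def D3_def D4_def D5_def D6_def D7_def
  have D0: "D1 \<noteq> 0" "D2 \<noteq> 0" "D3 \<noteq> 0" "D4 \<noteq> 0" "D5 \<noteq> 0" "D6 \<noteq> 0" "D7 \<noteq> 0"
    using nz by (auto simp: D)
  have quot: "b - d * A / (q * B) = D2 / (q * B)" "b - d / (q * B) = D3 / (q * B)"
    "b - d * q * A / B = D7 / B" "b - d * A / B = (b * B - d * A) / B"
    "a - b * q * A * B = - D1"
    "u * b - a * d / B = (u * b * B - a * d) / B"
    "u * b - a * d / (q * A * B) = (u * b * q * A * B - a * d) / (q * A * B)"
    using nz by (simp_all add: D divide_simps mult_ac)
  have diffs: "\<beta> (Suc r) - z (Suc (m + r)) =
      q * B * (b - u * A) * (u * b * q * q * A * B * B - a * d) / (u * b * q * q * A * B * B)"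
    "\<beta> (Suc r) - \<alpha> m = D1 * D2 / (b * q * A * B)"
    "\<beta> r - \<alpha> (Suc m) = D1 * D7 / (b * q * A * B)"
    "z (Suc (m + r)) - \<alpha> (Suc m) =
      (u * q * q * A * A * B - a) * (q * A * (u * B - d)) / (u * q * q * A * A * B)"
    unfolding beta_minus_alpha beta_minus_z z_minus_alpha
    by (simp_all add: D A_def[symmetric] B_def[symmetric] power_add algebra_simps)
  \<comment> \<open>Once \<open>K'\<close> is taken out, the three terms are the three products in
    \<open>coefficient_identity\<close>.\<close>
  define K' where "K' = K * b * (b - u * A) * (d - u * B) / (u * B * B * D1 * D5 * D6 * D3 * D4)"
  have C01': "(\<beta> (Suc r) - z (Suc (m + r))) / (\<beta> (Suc r) - \<alpha> m) * mixed_coeff a d b u q m (Suc r) =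
      K' * ((a - u * A) * (u * b * q * q * A * B * B - a * d) * (1 - q * A) * B * (b - d * q * A))"
  proof -
    have "q * B * x * y / (u * b * q * q * A * B * B) / (D1 * D2 / (b * q * A * B)) *
       (K * (b * w * v * (D2 / (q * B)) / (B * D6 * (D3 / (q * B))))) =
      K * b * x * v / (u * B * B * D1 * D5 * D6 * D3 * D4) * (w * y * D5 * B * D4)" for x y v w
      using D0 nz(1,2) u0 b0 q0 by (simp add: field_simps)
    then show ?thesis
      unfolding C01 diffs quot K'_def by (simp only: D5_def[symmetric] D4_def[symmetric] D6_def[symmetric])
  qed
  have C10': "(z (Suc (m + r)) - \<alpha> (Suc m)) / (\<beta> r - \<alpha> (Suc m)) * mixed_coeff a d b u q (Suc m) r =
      - (K' * (A * (u * b * B - a * d) * (u * q * q * A * A * B - a) * (1 - q * B) * (b * q * B - d)))"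
  proof -
    have "x * (q * A * v) / (u * q * q * A * A * B) / (D1 * D7 / (b * q * A * B)) *
       (K * (A * y * (w / B) * (D7 / B) / (D5 * D4))) =
      - (K * b * y * - v / (u * B * B * D1 * D5 * D6 * D3 * D4) * (A * w * x * D6 * D3))" for x y v w
      using D0 nz(1,2) u0 b0 q0 by (simp add: field_simps)
    \<comment> \<open>The factor \<open>u * B - d\<close> comes from the node difference, while
      \<open>K'\<close> contains its negative; hence the minus sign of this term.\<close>
    from this[where v = "u * B - d"] show ?thesis
      unfolding C10 diffs minus_diff_eq quot K'_def
      by (simp only: D5_def[symmetric] D4_def[symmetric] D6_def[symmetric] D3_def[symmetric])
  qed
  have C11': "mixed_coeff a d b u q (Suc m) (Suc r) =
     K' * ((1 - q * q * A * B) * (a - u * q * A * B) * (u * b * q * A * B - a * d) * (b * B - d * A))"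
  proof -
    have "- (K * (b * A * w * x * y * (s / (q * A * B)) * v * (t / B) /
       (B * u * D5 * D6 * - D1 * (D3 / (q * B)) * D4))) =
      K * b * x * v / (u * B * B * D1 * D5 * D6 * D3 * D4) * (w * y * s * t)" for s t x y v w
      using D0 nz(1,2) u0 b0 q0 by (simp add: field_simps)
    then show ?thesis
      unfolding C11 quot K'_def
      by (simp only: D5_def[symmetric] D4_def[symmetric] D6_def[symmetric] D3_def[symmetric])
  qed
  show ?thesis
    unfolding C01' C10' C11' coefficient_identity by (simp add: algebra_simps)
qed

lemma mixed_coeff_expansion:
  assumes "n \<le> N"
  shows "(\<Sum>r\<le>n. smult (mixed_coeff a d b u q (n - r) r) (mixed_basis \<alpha> \<beta> (n - r) r)) =
    (\<Prod>l<n. [:- z l, 1:])"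
  using beta_neq_alpha mixed_coeff_Suc_0 mixed_coeff_0_Suc mixed_coeff_Suc_Suc assms
  by (intro mixed_basis_expansion[where N = N])
    (use b_neq[of 0] in \<open>auto simp: mixed_coeff_def qbinom_def qpoch_def\<close>)

end

section \<open>Products over pairs of indices\<close>

definition index_pairs :: "nat \<Rightarrow> (nat \<times> nat) set" where
  "index_pairs n = {(j, i). j < i \<and> i \<le> n}"

text \<open>For \<open>m = n + 1 - k\<close> this is the index set of the double product in the
  theorem.\<close>

definition index_pairs_avoiding :: "nat \<Rightarrow> nat \<Rightarrow> (nat \<times> nat) set" where
  "index_pairs_avoiding n m = {(j, i). j < i \<and> i \<le> n \<and> j \<noteq> m \<and> i \<noteq> m}"

lemma finite_index_pairs: "finite (index_pairs n)"
  by (rule finite_subset[of _ "{..n} \<times> {..n}"]) (auto simp: index_pairs_def)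

text \<open>Substitute \<open>r = n - i\<close> and \<open>t - r = j\<close>; then
  \<open>t < n\<close> becomes \<open>j < i\<close>.\<close>

lemma prod_triangle_reindex:
  fixes f :: "nat \<Rightarrow> nat \<Rightarrow> 'a::comm_monoid_mult"
  shows "(\<Prod>t<n. \<Prod>r\<le>t. f r (t - r)) = (\<Prod>(j, i)\<in>index_pairs n. f (n - i) j)"
proof -
  have "(\<Prod>t<n. \<Prod>r\<le>t. f r (t - r)) = (\<Prod>(t, r)\<in>(SIGMA t:{..<n}. {..t}). f r (t - r))"
    by (simp add: prod.Sigma)
  also have "\<dots> = (\<Prod>(j, i)\<in>index_pairs n. f (n - i) j)"
    by (rule prod.reindex_bij_witness[of _ "\<lambda>(j, i). (n - i + j, n - i)" "\<lambda>(t, r). (t - r, n - r)"])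
      (auto simp: index_pairs_def)
  finally show ?thesis .
qed

text \<open>A pair that meets \<open>m\<close> is determined by its other entry \<open>x\<close>,
  and by symmetry its order does not matter.\<close>

lemma prod_index_pairs_split:
  fixes g :: "nat \<Rightarrow> nat \<Rightarrow> 'a::comm_monoid_mult"
  assumes sym: "\<And>i j. g i j = g j i" and m: "m \<le> n"
  shows "(\<Prod>(j, i)\<in>index_pairs n. g j i) =
    (\<Prod>(j, i)\<in>index_pairs_avoiding n m. g j i) * (\<Prod>x\<in>{..n} - {m}. g m x)"
proof -
  let ?S = "index_pairs n - index_pairs_avoiding n m"
  have sub: "index_pairs_avoiding n m \<subseteq> index_pairs n"
    by (auto simp: index_pairs_def index_pairs_avoiding_def)
  have "(\<Prod>(j, i)\<in>index_pairs n. g j i) =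
      (\<Prod>(j, i)\<in>?S. g j i) * (\<Prod>(j, i)\<in>index_pairs_avoiding n m. g j i)"
    by (rule prod.subset_diff[OF sub finite_index_pairs])
  also have "(\<Prod>(j, i)\<in>?S. g j i) = (\<Prod>x\<in>{..n} - {m}. g m x)"
    by (rule prod.reindex_bij_witness[of _ "\<lambda>x. (min m x, max m x)" "\<lambda>(j, i). if j = m then i else j"])
      (use m in \<open>auto simp: index_pairs_def index_pairs_avoiding_def min_def max_def sym[of m] split: if_splits\<close>)
  finally show ?thesis by (simp add: mult.commute)
qed

lemma prod_lessThan_add:
  fixes f :: "nat \<Rightarrow> 'a::comm_monoid_mult"
  shows "(\<Prod>x<s + m. f x) = (\<Prod>x<s. f x) * (\<Prod>e<m. f (s + e))"
  by (induction m) (simp_all add: mult_ac)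

section \<open>Evaluation of the determinant of node values\<close>

text \<open>With \<open>p\<close> inverse to \<open>q\<close>, the sequences \<alpha>, \<beta> and
  \<open>z\<close> all have this shape.\<close>

definition qsum :: "'a::comm_ring_1 \<Rightarrow> 'a \<Rightarrow> 'a \<Rightarrow> 'a \<Rightarrow> nat \<Rightarrow> 'a" where
  "qsum x y q p i = x * q ^ i + y * p ^ i"

text \<open>The arguments \<open>b'\<close>, \<open>u'\<close> and \<open>p\<close> stand for the inverses of \<open>b\<close>, \<open>u\<close> and \<open>q\<close>,
  and \<open>Q\<close> for the Gaussian binomial coefficient; as independent arguments they make
  both sides commute with every ring homomorphism.\<close>

definition node_det :: "nat \<Rightarrow> nat \<Rightarrow> 'a::comm_ring_1 \<Rightarrow> 'a \<Rightarrow> 'a \<Rightarrow> 'a \<Rightarrow> 'a \<Rightarrow> 'a \<Rightarrow> 'a \<Rightarrow> 'a \<Rightarrow> 'a" where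
  "node_det n s a d b b' u u' q p = det (mat n n (\<lambda>(l, j).
     (\<Prod>i<n - insert_index s j. qsum u (a * d * u') q p l - qsum d a q p i) *
     (\<Prod>i<insert_index s j. qsum u (a * d * u') q p l - qsum b (a * d * b') q p i)))"

definition node_det_value ::
  "nat \<Rightarrow> nat \<Rightarrow> 'a::comm_ring_1 \<Rightarrow> 'a \<Rightarrow> 'a \<Rightarrow> 'a \<Rightarrow> 'a \<Rightarrow> 'a \<Rightarrow> 'a \<Rightarrow> 'a \<Rightarrow> 'a \<Rightarrow> 'a" where
  "node_det_value n s a d b b' u u' q p Q =
     (- 1) ^ (n + s) * (\<Prod>j<n. \<Prod>i<j. qsum u (a * d * u') q p j - qsum u (a * d * u') q p i) *
     (Q * b ^ s * q ^ ((n - s) choose 2) * p ^ (s choose 2) * u' ^ n *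
      (\<Prod>i<n - s. b - u * q ^ i) * (\<Prod>i<s. a - u * q ^ (n - s + i)) *
      (\<Prod>i<n - s. u * b - a * d * p ^ (s + i)) * (\<Prod>i<s. d - u * q ^ i) *
      (\<Prod>t<n. (b * q ^ t - a) ^ t) *
      (\<Prod>(j, i)\<in>index_pairs_avoiding n (n - s). b - d * q ^ j * p ^ (n - i)) *
      (\<Prod>t<n. b' ^ Suc t * p ^ (Suc t choose 2)))"

context comm_ring_hom
begin

lemma hom_qsum: "hom (qsum x y q p i) = qsum (hom x) (hom y) (hom q) (hom p) i"
  by (simp add: qsum_def hom_distribs)

lemma hom_node_det:
  "hom (node_det n s a d b b' u u' q p) =
    node_det n s (hom a) (hom d) (hom b) (hom b') (hom u) (hom u') (hom q) (hom p)"
  unfolding node_det_def hom_det[symmetric]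
  by (rule arg_cong[where f = det], rule eq_matI) (auto simp: hom_distribs hom_qsum)

lemma hom_node_det_value:
  "hom (node_det_value n s a d b b' u u' q p Q) =
    node_det_value n s (hom a) (hom d) (hom b) (hom b') (hom u) (hom u') (hom q) (hom p) (hom Q)"
  unfolding node_det_value_def
  by (simp add: hom_distribs hom_qsum case_prod_beta)

end

context generic_parameters
begin

text \<open>In the factorization of \<open>\<beta> r - \<alpha> (t - r)\<close> the factor
  \<open>b * q ^ t - a\<close> depends on \<open>t\<close> alone. One of its \<open>t + 1\<close>
  copies and the pairs meeting \<open>n - s\<close> are kept apart, since they cancel against the
  denominator of \<open>mixed_coeff\<close>.\<close>

lemma prod_beta_minus_alpha:
  assumes s: "s \<le> n"
  shows "(\<Prod>t<n. \<Prod>r\<le>t. \<beta> r - \<alpha> (t - r)) =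
    (\<Prod>t<n. b * q ^ t - a) * (\<Prod>t<n. (b * q ^ t - a) ^ t) *
    (\<Prod>(j, i)\<in>index_pairs_avoiding n (n - s). b - d * q ^ j * inverse q ^ (n - i)) *
    (\<Prod>x\<in>{..n} - {n - s}. b - d * q ^ x / q ^ s) *
    (\<Prod>t<n. inverse b ^ Suc t * inverse q ^ (Suc t choose 2))"
proof -
  \<comment> \<open>Written this way the factor depends on \<open>i + j\<close> only, which gives
    the symmetry that \<open>prod_index_pairs_split\<close> asks for.\<close>
  define g where "g j i = b - d * q ^ (i + j) / q ^ n" for i j :: nat
  have g: "b - d * q ^ j * inverse q ^ (n - i) = g j i" if "i \<le> n" for i j
  proof -
    have "q ^ n = q ^ i * q ^ (n - i)" using that by (simp flip: power_add)
    then show ?thesis using q0 by (simp add: g_def power_add field_simps)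
  qed
  have gm: "g (n - s) x = b - d * q ^ x / q ^ s" for x
  proof -
    have "q ^ n = q ^ s * q ^ (n - s)" using s by (simp flip: power_add)
    then show ?thesis using q0 by (simp add: g_def power_add field_simps)
  qed
  have fac: "\<beta> r - \<alpha> (t - r) =
      (b * q ^ t - a) * (b - d * q ^ (t - r) * inverse q ^ r) * (inverse b * inverse q ^ (t - r))"
    if "r \<le> t" for r t
  proof -
    have "q ^ t = q ^ r * q ^ (t - r)" using that by (simp flip: power_add)
    then show ?thesis using that q0 b0 by (simp add: beta_minus_alpha power_add field_simps)
  qed
  have inv: "(\<Prod>r\<le>t. inverse b * inverse q ^ (t - r)) = inverse b ^ Suc t * inverse q ^ (Suc t choose 2)" for t
  proof -
    have "(\<Sum>r\<le>t. t - r) = Suc t choose 2"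
      using sum.nat_diff_reindex[of "\<lambda>i. i" "Suc t"] gauss_sum_nat[of t]
      by (simp add: lessThan_Suc_atMost choose_two atLeast0AtMost mult.commute del: sum.lessThan_Suc)
    then show ?thesis by (simp add: prod.distrib flip: power_sum)
  qed
  have distr: "(\<Prod>t<n. \<Prod>r\<le>t. x t * y t r * w t r) =
      (\<Prod>t<n. x t ^ Suc t) * (\<Prod>t<n. \<Prod>r\<le>t. y t r) * (\<Prod>t<n. \<Prod>r\<le>t. w t r)" for x :: "nat \<Rightarrow> 'a" and y w
    by (simp add: prod.distrib)
  have "(\<Prod>t<n. \<Prod>r\<le>t. \<beta> r - \<alpha> (t - r)) = (\<Prod>t<n. \<Prod>r\<le>t.
      (b * q ^ t - a) * (b - d * q ^ (t - r) * inverse q ^ r) * (inverse b * inverse q ^ (t - r)))"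
    by (intro prod.cong refl fac) simp
  also have "\<dots> = (\<Prod>t<n. (b * q ^ t - a) ^ Suc t) * (\<Prod>t<n. \<Prod>r\<le>t. b - d * q ^ (t - r) * inverse q ^ r) *
     (\<Prod>t<n. inverse b ^ Suc t * inverse q ^ (Suc t choose 2))"
    unfolding distr inv ..
  also have "(\<Prod>t<n. (b * q ^ t - a) ^ Suc t) = (\<Prod>t<n. b * q ^ t - a) * (\<Prod>t<n. (b * q ^ t - a) ^ t)"
    by (simp add: prod.distrib)
  also have "(\<Prod>t<n. \<Prod>r\<le>t. b - d * q ^ (t - r) * inverse q ^ r) = (\<Prod>(j, i)\<in>index_pairs n. g j i)"
    unfolding prod_triangle_reindex[of "\<lambda>r j. b - d * q ^ j * inverse q ^ r"]
    by (rule prod.cong) (auto simp: index_pairs_def g)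
  also have "\<dots> = (\<Prod>(j, i)\<in>index_pairs_avoiding n (n - s). g j i) * (\<Prod>x\<in>{..n} - {n - s}. g (n - s) x)"
    by (rule prod_index_pairs_split) (auto simp: g_def add.commute)
  also have "(\<Prod>(j, i)\<in>index_pairs_avoiding n (n - s). g j i) =
      (\<Prod>(j, i)\<in>index_pairs_avoiding n (n - s). b - d * q ^ j * inverse q ^ (n - i))"
    by (rule prod.cong) (auto simp: index_pairs_avoiding_def g)
  finally show ?thesis by (simp only: gm mult.assoc)
qed

text \<open>The restored factor at \<open>x = n - s\<close> completes the row
  \<open>x \<le> n\<close>, in which the exponents \<open>x - s\<close> run from \<open>- s\<close>
  to \<open>n - s\<close>; negative and nonnegative ones give the two products.\<close>

lemma prod_omitted_row:
  assumes s: "s \<le> n"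
  shows "(b - d * q ^ (n - s) / q ^ s) * (\<Prod>x\<in>{..n} - {n - s}. b - d * q ^ x / q ^ s) =
    (\<Prod>e\<le>n - s. b - d * q ^ e) * (\<Prod>e<s. b - d / q ^ Suc e)"
proof -
  define f where "f x = b - d * q ^ x / q ^ s" for x
  have low: "f (s - Suc e) = b - d / q ^ Suc e" if "e < s" for e
  proof -
    have "q ^ s = q ^ Suc e * q ^ (s - Suc e)" using that by (simp flip: power_add power_Suc)
    then show ?thesis using q0 by (simp add: f_def field_simps)
  qed
  have "f (n - s) * (\<Prod>x\<in>{..n} - {n - s}. f x) = (\<Prod>x\<le>n. f x)"
    by (rule prod.remove[symmetric]) auto
  also have "\<dots> = (\<Prod>x<s + Suc (n - s). f x)"
    using s by (simp add: lessThan_Suc_atMost flip: prod.lessThan_Suc)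
  also have "\<dots> = (\<Prod>x<s. f x) * (\<Prod>e<Suc (n - s). f (s + e))"
    by (rule prod_lessThan_add)
  also have "(\<Prod>x<s. f x) = (\<Prod>e<s. f (s - Suc e))"
    by (rule prod.nat_diff_reindex[symmetric])
  also have "\<dots> = (\<Prod>e<s. b - d / q ^ Suc e)"
    by (rule prod.cong) (auto simp: low simp del: power_Suc)
  also have "(\<Prod>e<Suc (n - s). f (s + e)) = (\<Prod>e\<le>n - s. b - d * q ^ e)"
    using q0 by (simp add: f_def power_add lessThan_Suc_atMost del: prod.lessThan_Suc)
  finally show ?thesis by (simp add: f_def mult.commute)
qed

text \<open>The expansion coefficient supplies the denominators \<open>D\<close> and
  \<open>G\<close>, and the product of the \<open>\<beta> r - \<alpha> i\<close> cancels both. Apart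
  from the Gaussian binomial, only inverses of \<open>b\<close>, \<open>u\<close> and
  \<open>q\<close> remain.\<close>

lemma node_det_generic:
  assumes n: "n \<le> N" and s: "s \<le> n"
  shows "node_det n s a d b (inverse b) u (inverse u) q (inverse q) =
    node_det_value n s a d b (inverse b) u (inverse u) q (inverse q) (qbinom q n s)"
proof -
  define m where "m = n - s"
  have nm: "m + s = n" using s by (simp add: m_def)
  have qs: "qsum d a q (inverse q) = \<alpha>" "qsum b (a * d * inverse b) q (inverse q) = \<beta>"
    "qsum u (a * d * inverse u) q (inverse q) = z"
    by (auto simp: fun_eq_iff qsum_def \<alpha>_def \<beta>_def z_def divide_inverse power_inverse mult_ac add.commute)
  define X where "X = qbinom q n s * b ^ s * q ^ (m choose 2) *
      (\<Prod>i<m. b - u * q ^ i) * (\<Prod>i<s. a - u * q ^ (m + i)) *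
      (\<Prod>i<m. u * b - a * d / q ^ (s + i)) * (\<Prod>i<s. d - u * q ^ i)"
  define D where "D = (\<Prod>t<n. a - b * q ^ t)"
  define G where "G = (\<Prod>e\<le>m. b - d * q ^ e) * (\<Prod>e<s. b - d / q ^ Suc e)"
  define R where "R = (\<Prod>x\<in>{..n} - {m}. b - d * q ^ x / q ^ s)"
  define E where "E = (\<Prod>t<n. (b * q ^ t - a) ^ t) *
      (\<Prod>(j, i)\<in>index_pairs_avoiding n m. b - d * q ^ j * inverse q ^ (n - i)) *
      (\<Prod>t<n. inverse b ^ Suc t * inverse q ^ (Suc t choose 2))"
  have D0: "D \<noteq> 0" using a_neq by (auto simp: D_def)
  have G0: "G \<noteq> 0" using b_neq d_neq q0 by (auto simp: G_def field_simps simp flip: power_Suc)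
  have GR: "(b - d * q ^ m / q ^ s) * R = G"
    unfolding G_def R_def m_def by (rule prod_omitted_row[OF s])
  have C: "mixed_coeff a d b u q m s =
      (- 1) ^ n * X * (b - d * q ^ m / q ^ s) / (q ^ (s choose 2) * u ^ n * D * G)"
    unfolding mixed_coeff_def nm X_def D_def G_def by (simp only: mult_ac)
  have "(\<Prod>t<n. b * q ^ t - a) = (\<Prod>t<n. (- 1) * (a - b * q ^ t))"
    by simp
  then have D': "(\<Prod>t<n. b * q ^ t - a) = (- 1) ^ n * D"
    unfolding D_def by (simp only: prod.distrib) simp
  have BA: "(\<Prod>t<n. \<Prod>r\<le>t. \<beta> r - \<alpha> (t - r)) = (- 1) ^ n * D * E * R"
    unfolding prod_beta_minus_alpha[OF s] D' E_def R_def m_def by (simp only: mult_ac)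
  have "mixed_coeff a d b u q m s * (\<Prod>t<n. \<Prod>r\<le>t. \<beta> r - \<alpha> (t - r)) =
      ((- 1) ^ n * (- 1) ^ n) * (X * E) * (((b - d * q ^ m / q ^ s) * R) / G) * (D / D) / (q ^ (s choose 2) * u ^ n)"
    unfolding C BA by (simp only: times_divide_eq_left times_divide_eq_right divide_divide_eq_left mult_ac)
  also have "\<dots> = X * E / (q ^ (s choose 2) * u ^ n)"
    unfolding GR using D0 G0 by (simp flip: power_add mult_2)
  finally have W: "mixed_coeff a d b u q m s * (\<Prod>t<n. \<Prod>r\<le>t. \<beta> r - \<alpha> (t - r)) =
      X * E * inverse q ^ (s choose 2) * inverse u ^ n"
    by (simp add: divide_inverse power_inverse mult_ac)
  have "node_det n s a d b (inverse b) u (inverse u) q (inverse q) =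
      det (mat n n (\<lambda>(l, j). poly (mixed_basis \<alpha> \<beta> (n - insert_index s j) (insert_index s j)) (z l)))"
    unfolding node_det_def qs by (simp add: mixed_basis_def poly_prod)
  also have "\<dots> = (- 1) ^ (n + s) * (\<Prod>j<n. \<Prod>i<j. z j - z i) *
      (mixed_coeff a d b u q m s * (\<Prod>t<n. \<Prod>r\<le>t. \<beta> r - \<alpha> (t - r)))"
    unfolding det_mixed_basis_omit[OF mixed_coeff_expansion[OF n] s] m_def by (simp only: mult_ac)
  also have "\<dots> = node_det_value n s a d b (inverse b) u (inverse u) q (inverse q) (qbinom q n s)"
    unfolding W node_det_value_def qs m_def[symmetric] X_def E_def
    by (simp only: divide_inverse power_inverse mult_ac)
  finally show ?thesis .
qed

end

text \<open>The coefficients \<^const>\<open>mixed_coeff\<close> have denominators \<open>a - b q\<^sup>t\<close> and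
  \<open>b - d q\<^sup>e\<close> that may vanish. Over the rational functions in \<open>X\<close> they do not vanish for
  \<open>a + X\<close> and \<open>d + X\<close>; the resulting identity is one between polynomials, so \<open>X = 0\<close> is allowed.\<close>

lemma node_det_eq:
  fixes a d b u q :: "'a::field"
  assumes "u \<noteq> 0" "b \<noteq> 0" "q \<noteq> 0" and q: "\<And>i. i < n \<Longrightarrow> q ^ Suc i \<noteq> 1" and s: "s \<le> n"
  shows "node_det n s a d b (inverse b) u (inverse u) q (inverse q) =
    node_det_value n s a d b (inverse b) u (inverse u) q (inverse q) (qbinom q n s)"
proof -
  define k :: "'a \<Rightarrow> 'a poly fract" where "k x = to_fract [:x:]" for x
  have "k (x + y) = k x + k y" "k (x * y) = k x * k y" "k 1 = 1" "k 0 = 0" for x y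
    unfolding k_def to_fract_add[symmetric] to_fract_mult[symmetric]
    by (simp_all add: one_pCons[symmetric])
  then interpret k: field_hom k
    by unfold_locales
  have fract: "comm_ring_hom (to_fract :: 'a poly \<Rightarrow> 'a poly fract)"
    by unfold_locales auto
  have ev: "comm_ring_hom (\<lambda>p :: 'a poly. poly p 0)"
    by unfold_locales auto
  define a' d' where "a' = to_fract [:a, 1:]" and "d' = to_fract [:d, 1:]"
  have k_inj: "k x = k y \<longleftrightarrow> x = y" for x y
    by (simp add: k_def)
  have kq: "qbinom (k q) n s = k (qbinom q n s)"
    by (simp add: qbinom_def qpoch_def hom_distribs)
  interpret generic_parameters a' d' "k b" "k u" "k q" n
  proof
    show "k u \<noteq> 0" "k b \<noteq> 0" "k q \<noteq> 0" using assms(1-3) by (simp_all add: k_def)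
    show "k q ^ Suc i \<noteq> 1" if "i < n" for i
      using q[OF that] k_inj[of "q ^ Suc i" 1] by (simp add: hom_distribs)
    \<comment> \<open>\<open>a'\<close> and \<open>d'\<close> have degree one in \<open>X\<close>,
      also after multiplication by a nonzero constant, so they never equal a constant.\<close>
    show "a' \<noteq> k b * k q ^ t" for t
      unfolding k.hom_power[symmetric] k.hom_mult[symmetric] by (simp add: k_def a'_def)
    show "d' \<noteq> k b * k q ^ t" for t
      unfolding k.hom_power[symmetric] k.hom_mult[symmetric] by (simp add: k_def d'_def)
    show "k b \<noteq> d' * k q ^ t" for t
      unfolding k.hom_power[symmetric] using assms(3)
      by (simp add: k_def d'_def flip: to_fract_mult)
  qed
  have "node_det n s a' d' (k b) (k (inverse b)) (k u) (k (inverse u)) (k q) (k (inverse q)) =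
    node_det_value n s a' d' (k b) (k (inverse b)) (k u) (k (inverse u)) (k q) (k (inverse q)) (k (qbinom q n s))"
    using node_det_generic[OF order_refl s] by (simp add: kq k.hom_inverse)
  \<comment> \<open>Both sides are images under the injective \<open>to_fract\<close>, which can be
    stripped.\<close>
  then have "node_det n s [:a, 1:] [:d, 1:] [:b:] [:inverse b:] [:u:] [:inverse u:] [:q:] [:inverse q:] =
    node_det_value n s [:a, 1:] [:d, 1:] [:b:] [:inverse b:] [:u:] [:inverse u:] [:q:] [:inverse q:] [:qbinom q n s:]"
    unfolding a'_def d'_def k_def comm_ring_hom.hom_node_det[OF fract, symmetric]
      comm_ring_hom.hom_node_det_value[OF fract, symmetric] by simp
  from arg_cong[OF this, of "\<lambda>p. poly p 0"] show ?thesis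
    by (simp add: comm_ring_hom.hom_node_det[OF ev] comm_ring_hom.hom_node_det_value[OF ev])
qed

section \<open>Supersymmetric complete functions as sums of residues\<close>

lemma fps_of_poly_one_minus: "fps_of_poly [:1, - y:] = 1 - fps_const (y :: 'a::field) * fps_X"
  by (simp add: fps_of_poly_linear' flip: fps_const_neg)

lemma fps_of_poly_prod_mset_linear:
  "(\<Prod>y\<in>#Y. 1 - fps_const (y :: 'a::field) * fps_X) = fps_of_poly (\<Prod>y\<in>#Y. [:1, - y:])"
  by (induction Y) (simp_all add: fps_of_poly_mult fps_of_poly_one_minus del: mult_pCons_left)

lemma degree_prod_mset_le: "degree (\<Prod>y\<in>#Y. [:1, - y:] :: 'a::comm_ring_1 poly) \<le> size Y"
proof (induction Y)
  case (add y Y)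
  have "degree ([:1, - y:] * (\<Prod>y\<in>#Y. [:1, - y:])) \<le> 1 + size Y"
    by (rule order.trans[OF degree_mult_le]) (use add in \<open>auto intro!: add_mono simp: degree_pCons_le\<close>)
  then show ?case by simp
qed simp

lemma fps_nth_inverse_linear:
  "fps_nth (inverse (1 - fps_const c * fps_X)) m = (c :: 'a::field) ^ m"
proof -
  have "(1 - fps_const c * fps_X) * Abs_fps (\<lambda>n. c ^ n) = 1"
    by (rule fps_ext) (auto simp: left_diff_distrib mult.assoc fps_X_mult_nth gr0_conv_Suc simp flip: power_Suc)
  then have "inverse (1 - fps_const c * fps_X) = Abs_fps (\<lambda>n. c ^ n)"
    by (simp add: fps_inverse_unique)
  then show ?thesis by simp
qed

text \<open>Division by \<open>D\<close> with Lagrange interpolation at the points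
  \<open>1 / x k\<close>: the remainder minus the interpolant \<open>S\<close> has degree below
  \<open>n\<close> and vanishes at \<open>n\<close> distinct points.\<close>

lemma poly_partial_fractions:
  fixes x :: "nat \<Rightarrow> 'a::field" and P :: "'a poly"
  assumes x0: "\<And>l. l < n \<Longrightarrow> x l \<noteq> 0" and inj: "inj_on x {..<n}"
  obtains Q where "P = (\<Prod>i<n. [:1, - x i:]) * Q +
      (\<Sum>l<n. smult (poly P (1 / x l) / (\<Prod>i\<in>{..<n} - {l}. 1 - x i / x l))
        (\<Prod>i\<in>{..<n} - {l}. [:1, - x i:]))"
    and "degree Q \<le> degree P - n"
proof -
  define D where "D = (\<Prod>i<n. [:1, - x i:])"
  define L where "L l = (\<Prod>i\<in>{..<n} - {l}. [:1, - x i:])" for l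
  define E where "E l = (\<Prod>i\<in>{..<n} - {l}. 1 - x i / x l)" for l
  define S where "S = (\<Sum>l<n. smult (poly P (1 / x l) / E l) (L l))"
  have degD: "degree D = n"
    unfolding D_def by (subst degree_prod_sum_eq) (auto simp: x0)
  have degL: "degree (L l) < n" if "l < n" for l
    unfolding L_def using that by (subst degree_prod_sum_eq) (auto simp: x0 card_Diff_singleton)
  have E0: "E l \<noteq> 0" if "l < n" for l
    using that x0 inj by (auto simp: E_def inj_on_def)
  have Lx: "poly (L l) (1 / x k) = (if l = k then E l else 0)" if "l < n" "k < n" for l k
    using that x0[of k] by (auto simp: L_def E_def poly_prod)
  have Sx: "poly S (1 / x k) = poly P (1 / x k)" if "k < n" for k
  proof -
    have "poly S (1 / x k) = (\<Sum>l<n. poly P (1 / x l) / E l * (if l = k then E l else 0))"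
      using that by (simp add: S_def poly_sum Lx)
    also have "\<dots> = poly P (1 / x k)"
      using that E0[of k] by (simp add: if_distrib[of "\<lambda>t. _ * t"] cong: if_cong)
    finally show ?thesis .
  qed
  have degS: "degree S < n" if "0 < n"
    unfolding S_def using that degL by (intro degree_sum_less) (auto intro: le_less_trans[OF degree_smult_le])
  define R where "R = P mod D - S"
  have R0: "R = 0"
  proof (rule ccontr)
    assume "R \<noteq> 0"
    have "0 < n"
    proof (rule ccontr)
      assume "\<not> 0 < n"
      then show False using \<open>R \<noteq> 0\<close> by (simp add: R_def D_def S_def)
    qed
    then have "degree R < n"
      using degS degree_mod_less[of D P] degD unfolding R_def
      by (intro degree_diff_less) force+
    moreover have "poly R (1 / x k) = 0" if "k < n" for k
    proof -
      have "poly D (1 / x k) = 0"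
        using that x0[OF that] by (auto simp: D_def poly_prod)
      moreover have "poly P (1 / x k) = poly (D * (P div D) + P mod D) (1 / x k)"
        by (simp only: mult_div_mod_eq)
      ultimately have "poly (P mod D) (1 / x k) = poly P (1 / x k)"
        by (simp only: poly_add poly_mult mult_zero_left add_0)
      then show ?thesis by (simp add: R_def Sx that)
    qed
    then have "card ((\<lambda>k. 1 / x k) ` {..<n}) \<le> card {y. poly R y = 0}"
      using \<open>R \<noteq> 0\<close> by (intro card_mono poly_roots_finite) auto
    moreover have "card ((\<lambda>k. 1 / x k) ` {..<n}) = n"
      using inj x0 by (subst card_image) (auto simp: inj_on_def)
    moreover have "card {y. poly R y = 0} \<le> degree R"
      using \<open>R \<noteq> 0\<close> by (rule card_poly_roots_bound)
    ultimately show False by simp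
  qed
  have "P = D * (P div D) + S" using R0 mult_div_mod_eq[of D P] by (simp add: R_def)
  moreover have "degree (P div D) \<le> degree P - n"
  proof (cases "P div D = 0")
    case False
    have "D \<noteq> 0" using False by auto
    have mod: "degree (P mod D) \<le> degree P"
    proof (cases "degree P < degree D")
      case True
      then show ?thesis by (simp add: mod_poly_less)
    next
      case ge: False
      then show ?thesis using degree_mod_less[OF \<open>D \<noteq> 0\<close>, of P] by auto
    qed
    have "n + degree (P div D) = degree (D * (P div D))"
      using False \<open>D \<noteq> 0\<close> degD by (simp add: degree_mult_eq)
    also have "D * (P div D) = P - P mod D"
      by (rule minus_mod_eq_mult_div[symmetric])
    also have "degree (P - P mod D) \<le> degree P"
      using mod by (intro degree_diff_le) auto
    finally show ?thesis by simp
  qed simp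
  ultimately show thesis
    using that unfolding D_def S_def L_def E_def by blast
qed

text \<open>The polynomial part \<open>Q\<close> has degree below \<open>m\<close> and does not
  reach the coefficient \<open>m\<close>; \<open>0 < m\<close> covers the case
  \<open>size Y \<le> n\<close>, where \<open>Q\<close> may be a constant. The remaining terms are
  geometric series.\<close>

lemma hsuper_partial_fractions:
  fixes x :: "nat \<Rightarrow> 'a::field"
  assumes x0: "\<And>l. l < n \<Longrightarrow> x l \<noteq> 0" and inj: "inj_on x {..<n}"
    and Y: "size Y < m + n" and m: "0 < m"
  shows "hsuper m {#x i. i \<in># mset_set {..<n}#} Y =
    (\<Sum>l<n. x l ^ m * (\<Prod>y\<in>#Y. 1 - y / x l) / (\<Prod>i\<in>{..<n} - {l}. 1 - x i / x l))"
proof -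
  define P where "P = (\<Prod>y\<in>#Y. [:1, - y:])"
  define D where "D = (\<Prod>i<n. [:1, - x i:])"
  define L where "L l = (\<Prod>i\<in>{..<n} - {l}. [:1, - x i:])" for l
  define E where "E l = (\<Prod>i\<in>{..<n} - {l}. 1 - x i / x l)" for l
  obtain Q where PQ: "P = D * Q + (\<Sum>l<n. smult (poly P (1 / x l) / E l) (L l))"
    and degQ: "degree Q \<le> degree P - n"
    using poly_partial_fractions[OF x0 inj, of P] unfolding D_def L_def E_def by blast
  have D0: "fps_nth (fps_of_poly D) 0 \<noteq> 0"
    by (simp add: D_def coeff_0_prod_list poly_prod flip: poly_0_coeff_0)
  have Qm: "coeff Q m = 0"
    using degQ degree_prod_mset_le[of Y] Y m by (intro coeff_eq_0) (auto simp: P_def)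
  have LD: "fps_of_poly (L l) * inverse (fps_of_poly D) = inverse (1 - fps_const (x l) * fps_X)" if "l < n" for l
  proof -
    have "D = [:1, - x l:] * L l"
      unfolding D_def L_def using that by (subst prod.remove[of _ l]) auto
    then have D: "fps_of_poly D = (1 - fps_const (x l) * fps_X) * fps_of_poly (L l)"
      by (simp only: fps_of_poly_mult fps_of_poly_one_minus)
    have "fps_nth (fps_of_poly (L l)) 0 \<noteq> 0"
      by (simp add: L_def poly_prod flip: poly_0_coeff_0)
    then show ?thesis
      unfolding D by (simp add: fps_inverse_mult mult.left_commute inverse_mult_eq_1')
  qed
  have ev: "poly P (1 / x l) = (\<Prod>y\<in>#Y. 1 - y / x l)" for l
    unfolding P_def by (induction Y) (auto simp: algebra_simps)
  have "hsuper m {#x i. i \<in># mset_set {..<n}#} Y = fps_nth (fps_of_poly P / fps_of_poly D) m"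
    unfolding hsuper_def fps_of_poly_prod_mset_linear
    by (simp add: P_def D_def prod_unfold_prod_mset multiset.map_comp comp_def)
  also have "fps_of_poly P / fps_of_poly D = fps_of_poly P * inverse (fps_of_poly D)"
    by (rule fps_divide_unit[OF D0])
  also have "\<dots> = fps_of_poly Q + (\<Sum>l<n. fps_const (poly P (1 / x l) / E l) *
      (fps_of_poly (L l) * inverse (fps_of_poly D)))"
    using inverse_mult_eq_1'[OF D0]
    by (subst PQ) (simp add: fps_of_poly_add fps_of_poly_mult fps_of_poly_sum fps_of_poly_smult
        distrib_right sum_distrib_right mult.assoc mult.left_commute)
  also have "\<dots> = fps_of_poly Q + (\<Sum>l<n. fps_const (poly P (1 / x l) / E l) *
      inverse (1 - fps_const (x l) * fps_X))"
    by (simp add: LD)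
  finally show ?thesis
    by (simp add: fps_sum_nth fps_nth_inverse_linear Qm ev E_def) (simp only: mult.commute)
qed

section \<open>Determinant of the residue matrix\<close>

lemma prod_off_diagonal:
  fixes f :: "nat \<Rightarrow> nat \<Rightarrow> 'a::comm_monoid_mult"
  shows "(\<Prod>l<n. \<Prod>i\<in>{..<n} - {l}. f i l) = (\<Prod>j<n. \<Prod>i<j. f i j * f j i)"
proof (induction n)
  case (Suc n)
  have "(\<Prod>l<Suc n. \<Prod>i\<in>{..<Suc n} - {l}. f i l) =
     (\<Prod>l<n. f n l * (\<Prod>i\<in>{..<n} - {l}. f i l)) * (\<Prod>i<n. f i n)"
  proof -
    have "{..<Suc n} - {l} = insert n ({..<n} - {l})" if "l < n" for l using that by auto
    moreover have "{..<Suc n} - {n} = {..<n}" by auto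
    ultimately show ?thesis by simp
  qed
  then show ?case using Suc by (simp add: prod.distrib mult_ac)
qed simp

text \<open>The transposed matrix is diagonal times Vandermonde in \<open>w l = 1 / x l\<close>, and
  the residue denominators contain both \<open>V\<close> and \<open>V'\<close>. The factor
  \<open>V'\<close> cancels because \<open>(x j + c / x j) - (x i + c / x i) = (w i - w j) * (x i *
  x j - c)\<close>. These differences may vanish, so they are multiplied in and not divided
  out.\<close>

lemma det_residue_matrix:
  fixes x :: "nat \<Rightarrow> 'a::field"
  assumes x0: "\<And>l. l < n \<Longrightarrow> x l \<noteq> 0" and inj: "inj_on x {..<n}"
  shows "det (mat n n (\<lambda>(i, l). x l ^ (n - i) / (\<Prod>i\<in>{..<n} - {l}. 1 - x i / x l))) *
    (\<Prod>j<n. \<Prod>i<j. (x j + c / x j) - (x i + c / x i)) =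
    (\<Prod>l<n. x l) * (\<Prod>j<n. \<Prod>i<j. x i * x j - c)"
proof -
  define w where "w l = 1 / x l" for l
  define E where "E l = (\<Prod>i\<in>{..<n} - {l}. 1 - x i / x l)" for l
  define V where "V = (\<Prod>j<n. \<Prod>i<j. w j - w i)"
  define V' where "V' = (\<Prod>j<n. \<Prod>i<j. w i - w j)"
  let ?A = "mat n n (\<lambda>(i, l). x l ^ (n - i) / E l)"
  have "?A\<^sup>T = mat n n (\<lambda>(l, k). if l = k then x l ^ n / E l else 0) * mat n n (\<lambda>(l, k). w l ^ k)"
  proof (rule eq_matI)
    fix l k assume "l < dim_row (mat n n (\<lambda>(l, k). if l = k then x l ^ n / E l else 0) * mat n n (\<lambda>(l, k). w l ^ k))"
      "k < dim_col (mat n n (\<lambda>(l, k). if l = k then x l ^ n / E l else 0) * mat n n (\<lambda>(l, k). w l ^ k))"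
    then have lk: "l < n" "k < n" by auto
    have "x l ^ n = x l ^ (n - k) * x l ^ k" using lk by (simp flip: power_add)
    moreover have "(\<Sum>i<n. (if l = i then x l ^ n / E l else 0) * w i ^ k) =
        (\<Sum>i\<in>{l}. x l ^ n / E l * w i ^ k)"
      using lk by (intro sum.mono_neutral_cong_right) auto
    ultimately show "?A\<^sup>T $$ (l, k) = (mat n n (\<lambda>(l, k). if l = k then x l ^ n / E l else 0) * mat n n (\<lambda>(l, k). w l ^ k)) $$ (l, k)"
      using lk x0[of l] by (simp add: scalar_prod_def w_def power_one_over atLeast0LessThan)
  qed auto
  then have "det ?A = det (mat n n (\<lambda>(l, k). if l = k then x l ^ n / E l else 0) * mat n n (\<lambda>(l, k). w l ^ k))"
    using det_transpose[of ?A n] by simp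
  also have "\<dots> = det (mat n n (\<lambda>(l, k). if l = k then x l ^ n / E l else 0)) * V"
    by (subst det_mult[of _ n]) (auto simp: det_vandermonde V_def)
  also have "det (mat n n (\<lambda>(l, k). if l = k then x l ^ n / E l else 0)) = (\<Prod>l<n. x l ^ n / E l)"
    by (subst det_lower_triangular[of n]) (auto simp: prod_list_diag_prod atLeast0LessThan)
  finally have detA: "det ?A = (\<Prod>l<n. x l ^ n) / (\<Prod>l<n. E l) * V"
    by (simp add: prod_dividef)
  \<comment> \<open>Uses \<open>1 - x i / x l = x i * (w i - w l)\<close>.\<close>
  have "(\<Prod>l<n. E l) = (\<Prod>l<n. \<Prod>i\<in>{..<n} - {l}. x i * (w i - w l))"
    unfolding E_def using x0 by (intro prod.cong refl) (auto simp: w_def field_simps)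
  also have "\<dots> = (\<Prod>j<n. \<Prod>i<j. x i * x j) * V * V'"
    unfolding prod_off_diagonal[of "\<lambda>i l. x i * (w i - w l)"] V_def V'_def
    by (simp add: mult_ac flip: prod.distrib)
  also have "(\<Prod>j<n. \<Prod>i<j. x i * x j) = (\<Prod>l<n. \<Prod>i\<in>{..<n} - {l}. x l)"
    unfolding prod_off_diagonal[of "\<lambda>i l. x l"] by (simp add: mult.commute)
  also have "\<dots> = (\<Prod>l<n. x l ^ (n - 1))"
    by (intro prod.cong refl) (simp add: card_Diff_singleton)
  finally have E: "(\<Prod>l<n. E l) = (\<Prod>l<n. x l ^ (n - 1)) * V * V'" .
  have z: "(\<Prod>j<n. \<Prod>i<j. (x j + c / x j) - (x i + c / x i)) = V' * (\<Prod>j<n. \<Prod>i<j. x i * x j - c)"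
    unfolding V'_def prod.distrib[symmetric]
    by (intro prod.cong refl) (use x0 in \<open>auto simp: w_def field_simps\<close>)
  have "x i \<noteq> x j" if "i < j" "j < n" for i j
    using inj that by (auto dest: inj_onD)
  then have "V \<noteq> 0" "V' \<noteq> 0"
    using x0 by (auto simp: V_def V'_def w_def) metis+
  moreover have "(\<Prod>l<n. x l ^ n) = (\<Prod>l<n. x l) * (\<Prod>l<n. x l ^ (n - 1))"
    unfolding prod.distrib[symmetric] by (intro prod.cong refl) (auto simp flip: power_Suc)
  moreover have "(\<Prod>l<n. x l ^ (n - 1)) \<noteq> 0" using x0 by auto
  ultimately show ?thesis
    unfolding E_def[symmetric] detA E z by simp
qed

section \<open>The multisets Y and the factorization of F\<close>

text \<open>Both cases of \<open>Yset\<close> belong to one family indexed by the number of b-pairs;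
  since \<open>insert_index s\<close> skips \<open>s\<close>, the columns run through this family
  with the member \<open>s\<close> left out.\<close>

lemma Yset_eq:
  assumes "j < n"
  shows "Yset n a b c q (j + 1) (s + 1) =
    Apart a c q {..<n - insert_index s j} + Bpart n b c q {1..insert_index s j}"
proof -
  have "{0..n - (j + 1)} = {..<n - j}" "{1..<j + 1} = {1..j}" "{0..<n - (j + 1)} = {..<n - Suc j}"
    using assms by auto
  then show ?thesis by (simp add: Yset_def insert_index_def)
qed

lemma size_Apart: "size (Apart a c q M) = 2 * card M"
  by (simp add: Apart_def)

lemma size_Bpart: "size (Bpart n b c q M) = 2 * card M"
  by (simp add: Bpart_def)

text \<open>For \<open>f * g = c\<close> one has
  \<open>(1 - f / x) * (1 - g / x) * x = x + c / x - (f + g)\<close>, one power of \<open>x\<close>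
  per pair.\<close>

lemma prod_mset_pairs:
  fixes x :: "'a::field"
  assumes "finite M" "x \<noteq> 0" and eq: "\<And>m. m \<in> M \<Longrightarrow> f m * g m = c"
  shows "(\<Prod>y\<in>#{#f m. m \<in># mset_set M#} + {#g m. m \<in># mset_set M#}. 1 - y / x) * x ^ card M =
    (\<Prod>m\<in>M. x + c / x - (f m + g m))"
proof -
  have "(\<Prod>y\<in>#{#f m. m \<in># mset_set M#} + {#g m. m \<in># mset_set M#}. 1 - y / x) * x ^ card M =
      (\<Prod>m\<in>M. (1 - f m / x) * (1 - g m / x) * x)"
    using assms(1) by (simp add: multiset.map_comp comp_def prod.distrib flip: prod_unfold_prod_mset)
  also have "\<dots> = (\<Prod>m\<in>M. x + c / x - (f m + g m))"
    using assms by (intro prod.cong refl) (auto simp: field_simps eq[symmetric])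
  finally show ?thesis .
qed

lemma prod_Apart:
  fixes x :: "'a::field"
  assumes "x \<noteq> 0" "a \<noteq> 0" "q \<noteq> 0"
  shows "(\<Prod>y\<in>#Apart a c q {..<M}. 1 - y / x) * x ^ M =
    (\<Prod>i<M. x + c / x - qsum (c / a) a q (inverse q) i)"
proof -
  have "(\<Prod>y\<in>#Apart a c q {..<M}. 1 - y / x) * x ^ card {..<M} =
    (\<Prod>i<M. x + c / x - (a * q powi (- int i) + c * q ^ i / a))"
    unfolding Apart_def
    by (rule prod_mset_pairs) (use assms in \<open>auto simp: power_int_minus field_simps\<close>)
  then show ?thesis
    by (simp add: qsum_def power_int_minus power_inverse add.commute)
qed

lemma prod_Bpart:
  fixes x :: "'a::field"
  assumes "x \<noteq> 0" "b \<noteq> 0" "q \<noteq> 0" and n: "1 \<le> n" and b': "b' = b / q ^ (n - 1)"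
  shows "(\<Prod>y\<in>#Bpart n b c q {1..r}. 1 - y / x) * x ^ r =
    (\<Prod>i<r. x + c / x - qsum b' (c * inverse b') q (inverse q) i)"
proof -
  have "(\<Prod>y\<in>#Bpart n b c q {1..r}. 1 - y / x) * x ^ card {1..r} =
    (\<Prod>m\<in>{1..r}. x + c / x - (b * q powi (int m - int n) + c * q powi (int n - int m) / b))"
    unfolding Bpart_def
    by (rule prod_mset_pairs) (use assms in \<open>auto simp: power_int_diff\<close>)
  \<comment> \<open>With \<open>m = i + 1\<close> the exponent \<open>m - n\<close> is
    \<open>i - (n - 1)\<close>, and \<open>b'\<close> absorbs the constant part.\<close>
  also have "\<dots> = (\<Prod>i<r. x + c / x -
      (b * q powi (int (Suc i) - int n) + c * q powi (int n - int (Suc i)) / b))"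
    by (rule prod.reindex_bij_witness[of _ Suc "\<lambda>m. m - 1"]) auto
  also have "\<dots> = (\<Prod>i<r. x + c / x - qsum b' (c * inverse b') q (inverse q) i)"
  proof -
    have "q ^ n = q * q ^ (n - 1)" using n by (simp flip: power_Suc)
    then have "b * q powi (int (Suc i) - int n) = b' * q ^ i"
      "c * q powi (int n - int (Suc i)) / b = c * inverse b' * inverse q ^ i" for i
      using assms(2,3) unfolding b'
      by (simp_all add: power_int_diff power_int_add power_inverse divide_inverse)
    then show ?thesis by (simp only: qsum_def)
  qed
  finally show ?thesis by simp
qed

lemma prod_Yset:
  fixes x :: "'a::field"
  assumes "x \<noteq> 0" "a \<noteq> 0" "b \<noteq> 0" "q \<noteq> 0" "1 \<le> n" "b' = b / q ^ (n - 1)" "j < n"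
    and r: "r = insert_index s j"
  shows "(\<Prod>y\<in>#Yset n a b c q (j + 1) (s + 1). 1 - y / x) * x ^ n =
    (\<Prod>i<n - r. x + c / x - qsum (c / a) a q (inverse q) i) *
    (\<Prod>i<r. x + c / x - qsum b' (c * inverse b') q (inverse q) i)"
proof -
  have "r \<le> n" using assms(7) r by (auto simp: insert_index_def)
  then have "x ^ n = x ^ (n - r) * x ^ r" by (simp flip: power_add)
  then have "(\<Prod>y\<in>#Yset n a b c q (j + 1) (s + 1). 1 - y / x) * x ^ n =
      ((\<Prod>y\<in>#Apart a c q {..<n - r}. 1 - y / x) * x ^ (n - r)) *
      ((\<Prod>y\<in>#Bpart n b c q {1..r}. 1 - y / x) * x ^ r)"
    unfolding Yset_eq[OF assms(7)] r[symmetric] by (simp add: mult_ac)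
  then show ?thesis
    using prod_Apart[OF assms(1,2,4)] prod_Bpart[OF assms(1,3,4,5,6)] by simp
qed

lemma inj_on_geometric:
  fixes u q :: "'a::field"
  assumes u0: "u \<noteq> 0" and q0: "q \<noteq> 0" and q: "\<And>i. i < n \<Longrightarrow> q ^ Suc i \<noteq> 1"
  shows "inj_on (\<lambda>l. u * q ^ l) {..<n}"
proof -
  have "u * q ^ i \<noteq> u * q ^ j" if "i < j" "j < n" for i j
  proof
    assume "u * q ^ i = u * q ^ j"
    moreover have "q ^ j = q ^ i * q ^ Suc (j - Suc i)" using that by (simp flip: power_add power_Suc)
    ultimately have "q ^ Suc (j - Suc i) = 1" using u0 q0 by (simp del: power_Suc)
    then show False using q[of "j - Suc i"] that by (simp del: power_Suc)
  qed
  then show ?thesis by (intro linorder_inj_onI) auto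
qed

text \<open>With rows counted from 0 the index of \<open>h\<close> is \<open>(n - i) + n\<close>. Of
  the powers of \<open>x l\<close>, \<open>n\<close> turn the product over \<open>Y\<close> into a
  function of \<open>x l + c / x l\<close>; the rest stays in the residue matrix, and the sum over
  \<open>l\<close> is a matrix product.\<close>

lemma Fdet_eq:
  fixes u a b c q :: "'a::field"
  assumes n: "1 \<le> n" and s: "s \<le> n" and u0: "u \<noteq> 0" and a0: "a \<noteq> 0" and b0: "b \<noteq> 0" and q0: "q \<noteq> 0"
    and q: "\<And>i. i < n \<Longrightarrow> q ^ Suc i \<noteq> 1" and b': "b' = b / q ^ (n - 1)"
  defines "x \<equiv> \<lambda>l. u * q ^ l"
  shows "Fdet n (s + 1) u a b c q =
    det (mat n n (\<lambda>(i, l). x l ^ (n - i) / (\<Prod>i\<in>{..<n} - {l}. 1 - x i / x l))) *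
    node_det n s a (c / a) b' (inverse b') u (inverse u) q (inverse q)"
proof -
  have x0: "x l \<noteq> 0" for l using u0 q0 by (simp add: x_def)
  have inj: "inj_on x {..<n}"
    unfolding x_def by (rule inj_on_geometric[OF u0 q0 q])
  define E where "E l = (\<Prod>i\<in>{..<n} - {l}. 1 - x i / x l)" for l
  define A where "A = mat n n (\<lambda>(i, l). x l ^ (n - i) / E l)"
  define B where "B = mat n n (\<lambda>(l, j).
     (\<Prod>i<n - insert_index s j. x l + c / x l - qsum (c / a) a q (inverse q) i) *
     (\<Prod>i<insert_index s j. x l + c / x l - qsum b' (c * inverse b') q (inverse q) i))"
  have U: "Uset n u q = {#x i. i \<in># mset_set {..<n}#}"
    by (simp add: Uset_def x_def atLeast0LessThan)
  have "mat n n (\<lambda>(i, j). hsuper (2 * n - (i + 1) + 1) (Uset n u q) (Yset n a b c q (j + 1) (s + 1))) = A * B"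
  proof (rule eq_matI)
    fix i j assume "i < dim_row (A * B)" "j < dim_col (A * B)"
    then have ij: "i < n" "j < n" by (auto simp: A_def B_def)
    have idx: "2 * n - (i + 1) + 1 = (n - i) + n" using ij by simp
    \<comment> \<open>As \<open>i < n\<close>, this is less than \<open>((n - i) + n) + n\<close>,
      the bound for the residue formula.\<close>
    have size: "size (Yset n a b c q (j + 1) (s + 1)) = 2 * n"
      unfolding Yset_eq[OF ij(2)] using ij by (simp add: size_Apart size_Bpart insert_index_def) arith
    have "hsuper ((n - i) + n) {#x i. i \<in># mset_set {..<n}#} (Yset n a b c q (j + 1) (s + 1)) =
      (\<Sum>l<n. x l ^ ((n - i) + n) * (\<Prod>y\<in>#Yset n a b c q (j + 1) (s + 1). 1 - y / x l) / E l)"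
      unfolding E_def by (rule hsuper_partial_fractions) (use x0 inj size ij in auto)
    also have "\<dots> = (\<Sum>l<n. x l ^ (n - i) / E l *
        ((\<Prod>y\<in>#Yset n a b c q (j + 1) (s + 1). 1 - y / x l) * x l ^ n))"
      by (simp add: power_add mult_ac)
    also have "\<dots> = (\<Sum>l<n. A $$ (i, l) * B $$ (l, j))"
      using ij by (simp add: prod_Yset[OF x0 a0 b0 q0 n b' ij(2) refl, simplified] A_def B_def)
    also have "\<dots> = (A * B) $$ (i, j)"
      using ij by (simp add: A_def B_def scalar_prod_def atLeast0LessThan)
    finally show "mat n n (\<lambda>(i, j). hsuper (2 * n - (i + 1) + 1) (Uset n u q)
        (Yset n a b c q (j + 1) (s + 1))) $$ (i, j) = (A * B) $$ (i, j)"
      unfolding U index_mat(1)[OF ij] prod.case idx .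
  qed (auto simp: A_def B_def)
  then have "Fdet n (s + 1) u a b c q = det A * det B"
    unfolding Fdet_def by (simp only:) (rule det_mult[of _ n], auto simp: A_def B_def)
  moreover have "det B = node_det n s a (c / a) b' (inverse b') u (inverse u) q (inverse q)"
  proof -
    have "x l + c / x l = qsum u (c * inverse u) q (inverse q) l" for l
      by (simp add: x_def qsum_def divide_inverse power_inverse mult_ac)
    then show ?thesis using a0 by (simp add: B_def node_det_def)
  qed
  ultimately show ?thesis by (simp add: A_def E_def)
qed

section \<open>Assembling the product formula\<close>

lemma cauchyP_eq_prod:
  assumes "x \<noteq> 0"
  shows "cauchyP q m x y = (\<Prod>i<m. x - y * q ^ i)"
proof -
  have "cauchyP q m x y = (\<Prod>i<m. x * (1 - y / x * q ^ i))"
    by (simp add: cauchyP_def qpoch_def prod.distrib)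
  also have "\<dots> = (\<Prod>i<m. x - y * q ^ i)"
    using assms by (intro prod.cong refl) (simp add: field_simps)
  finally show ?thesis .
qed

lemma sum_lessThan_id: "(\<Sum>t<n. t) = n choose 2"
  by (induction n) (simp_all add: choose2_0 choose2_Suc)

text \<open>Counts pairs: exactly \<open>n\<close> members of \<open>index_pairs n\<close> meet
  \<open>m\<close>.\<close>

lemma prod_avoiding_const:
  fixes x :: "'a::field"
  assumes "x \<noteq> 0" "m \<le> n"
  shows "(\<Prod>(j, i)\<in>index_pairs_avoiding n m. x) = x ^ (n choose 2)"
proof -
  have "(\<Prod>(j, i)\<in>index_pairs_avoiding n m. x) * x ^ n = (\<Prod>(j, i)\<in>index_pairs n. x)"
    using prod_index_pairs_split[of "\<lambda>_ _. x" m n] assms(2) by (simp add: card_Diff_singleton)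
  also have "\<dots> = (\<Prod>t<n. x ^ Suc t)"
    using prod_triangle_reindex[of "\<lambda>_ _. x" n] by simp
  also have "\<dots> = x ^ (n choose 2) * x ^ n"
    by (simp add: prod.distrib power_sum sum_lessThan_id mult.commute flip: power_sum)
  finally show ?thesis using assms(1) by simp
qed

text \<open>Balance of the powers of \<open>q\<close> in the theorem, in additive form to avoid
  truncated subtraction. The term \<open>(n - 1) * (n choose 2)\<close> comes from passing between
  \<open>b'\<close> and \<open>b\<close>.\<close>

lemma exponent_balance:
  assumes "n = m + s"
  shows "(n choose 2) + (m choose 2) + (\<Sum>t<n. t * t) + n * (n - 1) * (2 * n - 1) div 6 =
    (s choose 2) + (n - 1) * m + (\<Sum>t<n. Suc t choose 2) + (n - 1) * (n choose 2)"
proof -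
  have two: "2 * (k choose 2) = k * (k - 1)" for k :: nat
    by (induction k) (simp_all add: choose2_0 choose2_Suc algebra_simps)
  have "6 * (\<Sum>t<k. t * t) = k * (k - 1) * (2 * k - 1)" for k :: nat
  proof (induction k)
    case (Suc k)
    then show ?case by (cases k) (simp_all add: algebra_simps)
  qed simp
  \<comment> \<open>The division by 6 is exact, with the sum of squares as quotient.\<close>
  then have sq: "n * (n - 1) * (2 * n - 1) div 6 = (\<Sum>t<n. t * t)"
    by (metis nonzero_mult_div_cancel_left zero_neq_numeral)
  \<comment> \<open>The balance is the sum of this identity in \<open>n\<close> alone and the one
    below in \<open>m\<close> and \<open>s\<close>.\<close>
  have cub: "2 * (\<Sum>t<k. t * t) = (\<Sum>t<k. Suc t choose 2) + (k - 1) * (k choose 2)" for k :: nat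
  proof (induction k)
    case (Suc k)
    then show ?case using two[of k] by (cases k) (simp_all add: choose2_Suc algebra_simps)
  qed simp
  have "2 * ((n choose 2) + (m choose 2)) = 2 * ((s choose 2) + (n - 1) * m)"
    unfolding distrib_left two assms by (cases m; cases s) (simp_all add: algebra_simps)
  then show ?thesis unfolding sq using cub[of n] by simp
qed

(* The factor (-1)^(n choose 2 + n - k + 1) corrects a sign in the printed formula, which already
   fails for n = k = 1: there F = (u - b)(u - c/b), while the printed right-hand side is
   P_1(b,u) P_1(u,c/b) = (b - u)(u - c/b). *)
theorem theorem3p1:
  fixes u a b c q :: "'a::field" and n k :: nat
  assumes "n \<ge> 1" and "1 \<le> k" and "k \<le> n + 1"
    and "u \<noteq> 0" and "a \<noteq> 0" and "b \<noteq> 0" and "c \<noteq> 0" and "q \<noteq> 0"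
    and "\<And>i. 1 \<le> i \<Longrightarrow> i \<le> n \<Longrightarrow> q ^ i \<noteq> 1"
  shows "Fdet n k u a b c q =
    (- 1) ^ ((n choose 2) + (n + 1 - k)) *
    (qbinom q n (k - 1) * q powi (- int (n * (n - 1) * (2 * n - 1) div 6)) * b ^ (n choose 2) *
     (\<Prod>(i, j)\<in>{(i, j). 1 \<le> i \<and> i < j \<and> j \<le> n}. c - u ^ 2 * q ^ (i + j - 2)) *
     cauchyP q (n + 1 - k) b (u * q ^ (n - 1)) *
     cauchyP q (k - 1) a (u * q ^ (n + 1 - k)) *
     cauchyP q (n + 1 - k) u (c / b) *
     cauchyP q (k - 1) (c / a) u *
     (\<Prod>i\<in>{1..n - 1}. (1 - a * q ^ (i - 1) / b) ^ (n - i)) *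
     (\<Prod>j\<in>{0..n - 1} - {n + 1 - k}. \<Prod>i\<in>{j + 1..n} - {n + 1 - k}.
        1 - c * q ^ (i + j - 1) / (a * b)))"
proof -
  \<comment> \<open>\<open>s\<close> is the index of the omitted member of the family, and
    \<open>m = n - s\<close>.\<close>
  define s m where "s = k - 1" and "m = n + 1 - k"
  define b' where "b' = b / q ^ (n - 1)"
  define C where "C = n choose 2"
  define x where "x = (\<lambda>l :: nat. u * q ^ l)"
  have k: "k = s + 1" and nms: "n = m + s" and s: "s \<le> n" and ns: "n - s = m" and mn: "m \<le> n"
    using assms(2,3) by (auto simp: s_def m_def)
  note u0 = assms(4) and a0 = assms(5) and b0 = assms(6) and c0 = assms(7) and q0 = assms(8)
  have q: "q ^ Suc i \<noteq> 1" if "i < n" for i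
    using assms(9)[of "Suc i"] that by simp
  have b'0: "b' \<noteq> 0" using b0 q0 by (simp add: b'_def)
  have bb': "b = b' * q ^ (n - 1)" using q0 by (simp add: b'_def)
  have x0: "x l \<noteq> 0" for l using u0 q0 by (simp add: x_def)
  have inj: "inj_on x {..<n}"
    unfolding x_def by (rule inj_on_geometric[OF u0 q0 q])

  \<comment> \<open>Each of the following facts rewrites one factor of the two determinants; the
    split-off powers of \<open>b'\<close> and \<open>q\<close> are balanced at the end.\<close>
  have f1: "(\<Prod>i<m. b' - u * q ^ i) = cauchyP q m b (u * q ^ (n - 1)) / q ^ ((n - 1) * m)"
  proof -
    have "cauchyP q m b (u * q ^ (n - 1)) = (\<Prod>i<m. q ^ (n - 1) * (b' - u * q ^ i))"
      unfolding cauchyP_eq_prod[OF b0] by (rule prod.cong) (simp_all add: bb' algebra_simps)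
    also have "\<dots> = q ^ ((n - 1) * m) * (\<Prod>i<m. b' - u * q ^ i)"
      by (simp add: prod.distrib power_mult)
    finally show ?thesis using q0 by simp
  qed
  have f2: "(\<Prod>i<s. a - u * q ^ (m + i)) = cauchyP q s a (u * q ^ m)"
    unfolding cauchyP_eq_prod[OF a0] by (simp add: power_add mult.assoc)
  \<comment> \<open>Since \<open>c * inverse q ^ (s + i)\<close> equals
    \<open>b' * (c / b) * q ^ (m - 1 - i)\<close>, the Cauchy polynomial appears with its factors in
    reverse order.\<close>
  have f3: "(\<Prod>i<m. u * b' - a * (c / a) * inverse q ^ (s + i)) = b' ^ m * cauchyP q m u (c / b)"
  proof -
    have "(\<Prod>i<m. u * b' - a * (c / a) * inverse q ^ (s + i)) =
        (\<Prod>i<m. b' * (u - c / b * q ^ (m - Suc i)))"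
    proof (rule prod.cong)
      fix i assume "i \<in> {..<m}"
      then have "q ^ (n - 1) = q ^ (s + i) * q ^ (m - Suc i)"
        using nms by (simp add: add.commute flip: power_add)
      then show "u * b' - a * (c / a) * inverse q ^ (s + i) = b' * (u - c / b * q ^ (m - Suc i))"
        using a0 b'0 q0 unfolding bb' by (simp add: field_simps)
    qed simp
    also have "\<dots> = b' ^ m * (\<Prod>i<m. u - c / b * q ^ (m - Suc i))"
      by (simp add: prod.distrib)
    also have "(\<Prod>i<m. u - c / b * q ^ (m - Suc i)) = cauchyP q m u (c / b)"
      unfolding cauchyP_eq_prod[OF u0] by (rule prod.nat_diff_reindex)
    finally show ?thesis .
  qed
  have f4: "(\<Prod>i<s. c / a - u * q ^ i) = cauchyP q s (c / a) u"
    using a0 c0 by (simp add: cauchyP_eq_prod)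
  have f5: "(\<Prod>t<n. (b' * q ^ t - a) ^ t) =
      b' ^ C * q ^ (\<Sum>t<n. t * t) * (\<Prod>i\<in>{1..n - 1}. (1 - a * q ^ (i - 1) / b) ^ (n - i))"
  proof -
    have "(\<Prod>t<n. (b' * q ^ t - a) ^ t) = (\<Prod>t<n. b' ^ t * q ^ (t * t) * (1 - a * q ^ (n - 1 - t) / b) ^ t)"
    proof (rule prod.cong)
      fix t assume "t \<in> {..<n}"
      then have "q ^ (n - 1) = q ^ t * q ^ (n - 1 - t)" by (simp flip: power_add)
      then have "b' * q ^ t - a = b' * q ^ t * (1 - a * q ^ (n - 1 - t) / b)"
        using b'0 q0 unfolding bb' by (simp add: field_simps)
      then show "(b' * q ^ t - a) ^ t = b' ^ t * q ^ (t * t) * (1 - a * q ^ (n - 1 - t) / b) ^ t"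
        by (simp add: power_mult_distrib power_mult)
    qed simp
    also have "\<dots> = b' ^ C * q ^ (\<Sum>t<n. t * t) * (\<Prod>t<n. (1 - a * q ^ (n - 1 - t) / b) ^ t)"
      by (simp add: prod.distrib power_sum C_def flip: sum_lessThan_id)
    \<comment> \<open>The factor at \<open>t = 0\<close> has exponent 0.\<close>
    also have "(\<Prod>t<n. (1 - a * q ^ (n - 1 - t) / b) ^ t) = (\<Prod>t\<in>{1..n - 1}. (1 - a * q ^ (n - 1 - t) / b) ^ t)"
      by (rule prod.mono_neutral_right) (auto simp: not_le Suc_le_eq)
    also have "\<dots> = (\<Prod>i\<in>{1..n - 1}. (1 - a * q ^ (i - 1) / b) ^ (n - i))"
      by (rule prod.reindex_bij_witness[of _ "\<lambda>i. n - i" "\<lambda>i. n - i"]) auto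
    finally show ?thesis .
  qed
  have f6: "(\<Prod>(j, i)\<in>index_pairs_avoiding n m. b' - c / a * q ^ j * inverse q ^ (n - i)) =
      b' ^ C * (\<Prod>j\<in>{0..n - 1} - {m}. \<Prod>i\<in>{j + 1..n} - {m}. 1 - c * q ^ (i + j - 1) / (a * b))"
  proof -
    have "(\<Prod>(j, i)\<in>index_pairs_avoiding n m. b' - c / a * q ^ j * inverse q ^ (n - i)) =
        (\<Prod>(j, i)\<in>index_pairs_avoiding n m. b' * (1 - c * q ^ (i + j - 1) / (a * b)))"
    proof (rule prod.cong, safe)
      fix j i assume "(j, i) \<in> index_pairs_avoiding n m"
      then have "j < i" "i \<le> n" by (auto simp: index_pairs_avoiding_def)
      \<comment> \<open>Here \<open>j < i\<close> ensures that \<open>i + j - 1\<close> is not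
        truncated.\<close>
      then have "q ^ (i + j - 1) * q ^ (n - i) = q ^ j * q ^ (n - 1)"
        by (simp flip: power_add)
      then show "b' - c / a * q ^ j * inverse q ^ (n - i) = b' * (1 - c * q ^ (i + j - 1) / (a * b))"
        using a0 b'0 q0 unfolding bb' by (simp add: field_simps)
    qed
    also have "\<dots> = b' ^ C * (\<Prod>(j, i)\<in>index_pairs_avoiding n m. 1 - c * q ^ (i + j - 1) / (a * b))"
      using prod_avoiding_const[OF b'0 mn] by (simp add: case_prod_beta prod.distrib C_def)
    also have "(\<Prod>(j, i)\<in>index_pairs_avoiding n m. 1 - c * q ^ (i + j - 1) / (a * b)) =
        (\<Prod>(j, i)\<in>(SIGMA j:{0..n - 1} - {m}. {j + 1..n} - {m}). 1 - c * q ^ (i + j - 1) / (a * b))"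
      by (rule prod.cong) (auto simp: index_pairs_avoiding_def)
    finally show ?thesis by (simp add: prod.Sigma)
  qed
  have f7: "(\<Prod>t<n. inverse b' ^ Suc t * inverse q ^ (Suc t choose 2)) =
      1 / (b' ^ n * b' ^ C * q ^ (\<Sum>t<n. Suc t choose 2))"
  proof -
    have "(\<Prod>t<n. inverse b' ^ Suc t * inverse q ^ (Suc t choose 2)) =
        (\<Prod>t<n. inverse b') * (\<Prod>t<n. inverse b' ^ t) * (\<Prod>t<n. inverse q ^ (Suc t choose 2))"
      by (simp add: prod.distrib)
    also have "\<dots> = inverse b' ^ n * inverse b' ^ C * inverse q ^ (\<Sum>t<n. Suc t choose 2)"
      unfolding power_sum[symmetric] sum_lessThan_id C_def by simp
    finally show ?thesis by (simp add: power_inverse divide_inverse)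
  qed
  have f9: "(\<Prod>l<n. x l) = u ^ n * q ^ C"
    by (simp add: x_def prod.distrib C_def flip: power_sum sum_lessThan_id)
  \<comment> \<open>Reversing all \<open>n choose 2\<close> differences gives one part of the sign
    in the theorem.\<close>
  have f10: "(\<Prod>j<n. \<Prod>i<j. x i * x j - c) = (- 1) ^ C *
      (\<Prod>(i, j)\<in>{(i, j). 1 \<le> i \<and> i < j \<and> j \<le> n}. c - u ^ 2 * q ^ (i + j - 2))"
  proof -
    have "(\<Prod>j<n. \<Prod>i<j. x i * x j - c) = (\<Prod>j<n. \<Prod>i<j. (- 1) * (c - u ^ 2 * q ^ (i + j)))"
      by (simp add: x_def power2_eq_square power_add mult_ac)
    also have "\<dots> = (\<Prod>j<n. (- 1) ^ j) * (\<Prod>j<n. \<Prod>i<j. c - u ^ 2 * q ^ (i + j))"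
      by (simp only: prod.distrib prod_constant card_lessThan)
    also have "(\<Prod>j<n. (- 1) ^ j) = ((- 1) ^ C :: 'a)"
      by (simp add: C_def flip: power_sum sum_lessThan_id)
    also have "(\<Prod>j<n. \<Prod>i<j. c - u ^ 2 * q ^ (i + j)) =
        (\<Prod>(j, i)\<in>(SIGMA j:{..<n}. {..<j}). c - u ^ 2 * q ^ (i + j))"
      by (simp add: prod.Sigma)
    also have "\<dots> = (\<Prod>(i, j)\<in>{(i, j). 1 \<le> i \<and> i < j \<and> j \<le> n}. c - u ^ 2 * q ^ (i + j - 2))"
      by (rule prod.reindex_bij_witness[of _ "\<lambda>(i, j). (j - 1, i - 1)" "\<lambda>(j, i). (Suc i, Suc j)"]) auto
    finally show ?thesis .
  qed

  define detA where "detA = det (mat n n (\<lambda>(i, l). x l ^ (n - i) / (\<Prod>i\<in>{..<n} - {l}. 1 - x i / x l)))"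
  define V where "V = (\<Prod>j<n. \<Prod>i<j. (x j + c / x j) - (x i + c / x i))"
  have detAV: "detA * V = (\<Prod>l<n. x l) * (\<Prod>j<n. \<Prod>i<j. x i * x j - c)"
    unfolding detA_def V_def by (rule det_residue_matrix[OF x0 inj])
  have z: "qsum u (a * (c / a) * inverse u) q (inverse q) l = x l + c / x l" for l
    using a0 by (simp add: x_def qsum_def divide_inverse power_inverse mult_ac)
  have "Fdet n k u a b c q = detA * node_det n s a (c / a) b' (inverse b') u (inverse u) q (inverse q)"
    unfolding k detA_def x_def by (rule Fdet_eq[OF assms(1) s u0 a0 b0 q0 q b'_def])
  also have "node_det n s a (c / a) b' (inverse b') u (inverse u) q (inverse q) =
      node_det_value n s a (c / a) b' (inverse b') u (inverse u) q (inverse q) (qbinom q n s)"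
    by (rule node_det_eq[OF u0 b'0 q0 q s])
  finally have F: "Fdet n k u a b c q =
      detA * node_det_value n s a (c / a) b' (inverse b') u (inverse u) q (inverse q) (qbinom q n s)" .

  define E where "E = n * (n - 1) * (2 * n - 1) div 6"
  define S2 S3 where "S2 = (\<Sum>t<n. t * t)" and "S3 = (\<Sum>t<n. Suc t choose 2)"
  define P1 where "P1 = cauchyP q m b (u * q ^ (n - 1))"
  define P2 where "P2 = cauchyP q s a (u * q ^ m)"
  define P3 where "P3 = cauchyP q m u (c / b)"
  define P4 where "P4 = cauchyP q s (c / a) u"
  define T where "T = (\<Prod>i\<in>{1..n - 1}. (1 - a * q ^ (i - 1) / b) ^ (n - i))"
  define G where "G = (\<Prod>j\<in>{0..n - 1} - {m}. \<Prod>i\<in>{j + 1..n} - {m}. 1 - c * q ^ (i + j - 1) / (a * b))"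
  define H where "H = (\<Prod>(i, j)\<in>{(i, j). 1 \<le> i \<and> i < j \<and> j \<le> n}. c - u ^ 2 * q ^ (i + j - 2))"
  define Q where "Q = qbinom q n s"
  have "q ^ C * q ^ (m choose 2) * q ^ S2 * q ^ E = q ^ (s choose 2) * q ^ ((n - 1) * m) * q ^ S3 * q ^ ((n - 1) * C)"
    using exponent_balance[OF nms] by (simp add: C_def S2_def S3_def E_def flip: power_add)
  then have qs: "q ^ C * q ^ (m choose 2) * q ^ S2 / (q ^ (s choose 2) * q ^ ((n - 1) * m) * q ^ S3) =
      q ^ ((n - 1) * C) / q ^ E"
    using q0 by (simp add: field_simps)
  have "Fdet n k u a b c q = (- 1) ^ (n + s) * (detA * V) * (Q * b' ^ s * q ^ (m choose 2) *
      inverse q ^ (s choose 2) * inverse u ^ n * (P1 / q ^ ((n - 1) * m)) * P2 * (b' ^ m * P3) * P4 *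
      (b' ^ C * q ^ S2 * T) * (b' ^ C * G) * (1 / (b' ^ n * b' ^ C * q ^ S3)))"
    unfolding F node_det_value_def z V_def[symmetric] ns f1 f2 f3 f4 f5 f6 f7
      Q_def P1_def P2_def P3_def P4_def T_def G_def S2_def S3_def
    by (simp only: mult_ac)
  also have "detA * V = u ^ n * q ^ C * ((- 1) ^ C * H)"
    unfolding detAV f9 f10 H_def ..
  also have "b' ^ n = b' ^ m * b' ^ s"
    by (simp add: nms power_add)
  \<comment> \<open>The other part of the sign comes from Cramer's rule; \<open>n + s\<close> has
    the parity of \<open>m\<close>.\<close>
  also have "(- 1) ^ (n + s) = ((- 1) ^ m :: 'a)"
    by (simp add: nms power_add)
  also have "(- 1) ^ m * (u ^ n * q ^ C * ((- 1) ^ C * H)) * (Q * b' ^ s * q ^ (m choose 2) *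
      inverse q ^ (s choose 2) * inverse u ^ n * (P1 / q ^ ((n - 1) * m)) * P2 * (b' ^ m * P3) * P4 *
      (b' ^ C * q ^ S2 * T) * (b' ^ C * G) * (1 / (b' ^ m * b' ^ s * b' ^ C * q ^ S3))) =
      (- 1) ^ (C + m) * (Q * b' ^ C * H * P1 * P2 * P3 * P4 * T * G *
      (q ^ C * q ^ (m choose 2) * q ^ S2 / (q ^ (s choose 2) * q ^ ((n - 1) * m) * q ^ S3)))"
    using u0 b'0 q0 by (simp add: power_add power_inverse divide_inverse mult_ac) (simp add: field_simps)
  \<comment> \<open>The surplus \<open>q ^ ((n - 1) * C)\<close> turns \<open>b' ^ C\<close> into
    \<open>b ^ C\<close>.\<close>
  also have "\<dots> = (- 1) ^ (C + m) * (Q * q powi (- int E) * b ^ C * H * P1 * P2 * P3 * P4 * T * G)"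
    unfolding qs bb' by (simp add: power_int_minus power_mult_distrib divide_inverse mult_ac flip: power_mult)
  finally show ?thesis
    unfolding C_def E_def H_def P1_def P2_def P3_def P4_def T_def G_def Q_def s_def m_def .
qed

end
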